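(* Let $(\mathfrak A,\mathfrak B,\mathfrak C)$ be a $2$-color Sturmian lattice of rational slope $\alpha\in(0,1)$, and let $c$ be the central word of slope $\alpha$. Then each of the three words $(f_n)\in\{(a_i),(b_j),(c_k)\}$ has the form $(f_n)=\cdots c\,w_{-1}\,c\,w_0\,c\,w_1\,c\cdots$ for some $w_s\in\{01,10\}$ ($s\in\mathbb Z$), where $w_0=f_{-1}f_0$. More precisely, up to isometry exactly one of the following two cases occurs: (i) $(a_i)=\cdots c\,w_{-1}\,c\,w_0\,c\,w_1\,c\cdots$ (with $w_0=a_{-1}a_0$) with an arbitrary choice of $w_s\in\{01,10\}$, $(b_j)={}^{\infty}(1c0).(1c0)^{\infty}$ and $(c_k)={}^{\infty}(0c1).(0c1)^{\infty}$; (ii) either $(a_i)={}^{\infty}(0c1).0c0(1c0)^{\infty}$, $(b_j)=(c_k)={}^{\infty}(0c1)0c0.(1c0)^{\infty}$, or $(a_i)={}^{\infty}(1c0).1c1(0c1)^{\infty}$, $(b_j)=(c_k)={}^{\infty}(1c0)1c1.(0c1)^{\infty}$.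
   Context: Sturmian lattice: real sequences $(a(i)),(b(j)),(c(k))$ indexed by $\mathbb Z$ with consecutive differences $\ge1$, such that there exists $V\subset\mathbb Z^3$ with $(0,0,0)\in V$, for each pair of two indices exactly one third index completing a triple in $V$, and $|a(i)+b(j)+c(k)|=1/2$ for $(i,j,k)\in V$. In the $2$-color case (all consecutive differences in all directions take at most two values) the widths lie in $\{\kappa,\kappa+1\}$, $\kappa$ the minimal width, and $a_i=0$ or $1$ according as $a(i+1)-a(i)=\kappa$ or $\kappa+1$ (similarly $b_j,c_k$); the slope is the limiting density of $1$'s. For an irreducible fraction $\alpha=p/q\in(0,1)$, the central word $c$ of slope $\alpha$ is the word of length $q-2$ such that $0c1=(\lfloor(n+1)\alpha\rfloor-\lfloor n\alpha\rfloor)_{n=0}^{q-1}$. Notation for bi-infinite words: a decimal point marks the position between indices $-1$ and $0$; ${}^{\infty}u$ denotes $\cdots uuu$ (infinitely many copies to the left), $u^{\infty}=uuu\cdots$ to the right; e.g. ${}^{\infty}(0c1)0c0.(1c0)^{\infty}$ has $0c0$ ending at index $-1$, preceded by copies of $0c1$, and copies of $1c0$ starting at index $0$. Isometries act by permuting the three directions and reversing orientation (in the plane realization with line directions at angles $0,2\pi/3,4\pi/3$).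
   Formalization: The forms of the three words (with w_0=f_{-1}f_0) and the cases (i), (ii) are asserted after a translation moving a suitable triple of V to (0,0,0); with the origin fixed the claim fails, e.g. for slope 1/2 a shift can give f_{-1}f_0=11. *)

theory Defs
  imports Complex_Main
begin

text \<open>
  A lattice is given by the positions of its lines in the three directions. In the plane, with unit
  normals \<open>u\<close>, \<open>v\<close>, \<open>w\<close> satisfying \<open>u + v + w = 0\<close>, the sequences \<open>(a, b, c)\<close> stand for the lines
  \<open>{x. x \<bullet> u = a i}\<close>, \<open>{x. x \<bullet> v = b j}\<close>, \<open>{x. x \<bullet> w = c k}\<close>.
\<close>

type_synonym lattice = "(int \<Rightarrow> real) \<times> (int \<Rightarrow> real) \<times> (int \<Rightarrow> real)"

definition separated :: "(int \<Rightarrow> real) \<Rightarrow> bool" where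
  "separated f \<longleftrightarrow> (\<forall>i. f (i + 1) - f i \<ge> 1)"

fun sturmian_lattice :: "lattice \<Rightarrow> bool" where
  "sturmian_lattice (a, b, c) \<longleftrightarrow>
     separated a \<and> separated b \<and> separated c \<and>
     (\<exists>V :: (int \<times> int \<times> int) set.
        (0, 0, 0) \<in> V \<and>
        (\<forall>i j. \<exists>!k. (i, j, k) \<in> V) \<and>
        (\<forall>i k. \<exists>!j. (i, j, k) \<in> V) \<and>
        (\<forall>j k. \<exists>!i. (i, j, k) \<in> V) \<and>
        (\<forall>i j k. (i, j, k) \<in> V \<longrightarrow> \<bar>a i + b j + c k\<bar> = 1 / 2))"

fun widths :: "lattice \<Rightarrow> real set" where
  "widths (a, b, c) =
     range (\<lambda>i. a (i + 1) - a i) \<union> range (\<lambda>j. b (j + 1) - b j) \<union> range (\<lambda>k. c (k + 1) - c k)"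

definition two_color :: "lattice \<Rightarrow> bool" where
  "two_color L \<longleftrightarrow> finite (widths L) \<and> card (widths L) \<le> 2"

definition min_width :: "lattice \<Rightarrow> real" where
  "min_width L = Min (widths L)"

text \<open>
  In a two-color Sturmian lattice every width is \<open>\<kappa>\<close> or \<open>\<kappa> + 1\<close>, where \<open>\<kappa>\<close> is the minimal
  width, so the letter \<open>0\<close> below stands for the width \<open>\<kappa>\<close>.
\<close>

definition color_word :: "real \<Rightarrow> (int \<Rightarrow> real) \<Rightarrow> int \<Rightarrow> int" where
  "color_word \<kappa> f i = (if f (i + 1) - f i = \<kappa> + 1 then 1 else 0)"

fun words :: "lattice \<Rightarrow> (int \<Rightarrow> int) \<times> (int \<Rightarrow> int) \<times> (int \<Rightarrow> int)" where
  "words (a, b, c) =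
     (let \<kappa> = min_width (a, b, c) in (color_word \<kappa> a, color_word \<kappa> b, color_word \<kappa> c))"

definition has_density :: "(int \<Rightarrow> int) \<Rightarrow> real \<Rightarrow> bool" where
  "has_density f \<alpha> \<longleftrightarrow>
     (\<lambda>n. real_of_int (\<Sum>i = - int n..<int n. f i) / real (2 * n)) \<longlonglongrightarrow> \<alpha>"

definition has_slope :: "lattice \<Rightarrow> real \<Rightarrow> bool" where
  "has_slope L \<alpha> \<longleftrightarrow>
     (case words L of (f, g, h) \<Rightarrow> has_density f \<alpha> \<and> has_density g \<alpha> \<and> has_density h \<alpha>)"

text \<open>
  Isometries. A translation of the plane adds offsets of sum \<open>0\<close> to the three sequences; the indices
  are then counted from a triple that becomes \<open>(0, 0, 0)\<close>. Unless all widths are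
  \<open>1\<close>, the result can only be a Sturmian lattice if this triple is a member of \<open>V\<close>.
\<close>

fun translated :: "lattice \<Rightarrow> lattice \<Rightarrow> bool" where
  "translated (a, b, c) L' \<longleftrightarrow>
     (\<exists>i j k x y z. x + y + z = 0 \<and>
        L' = (\<lambda>n. a (n + i) + x, \<lambda>n. b (n + j) + y, \<lambda>n. c (n + k) + z) \<and>
        sturmian_lattice L')"

fun reversed :: "lattice \<Rightarrow> lattice" where
  "reversed (a, b, c) = (\<lambda>n. - a (- n), \<lambda>n. - b (- n), \<lambda>n. - c (- n))"

fun direction_perms :: "lattice \<Rightarrow> lattice set" where
  "direction_perms (a, b, c) = {(a, b, c), (a, c, b), (b, a, c), (b, c, a), (c, a, b), (c, b, a)}"

definition isometric :: "lattice \<Rightarrow> lattice \<Rightarrow> bool" where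
  "isometric L L' \<longleftrightarrow>
     (\<exists>M \<in> direction_perms L. translated M L' \<or> translated (reversed M) L')"

text \<open>The central word of slope \<open>p / q\<close>, for coprime \<open>0 < p < q\<close>.\<close>

definition central_word :: "nat \<Rightarrow> nat \<Rightarrow> int list" where
  "central_word p q =
     map (\<lambda>n. \<lfloor>real (n + 1) * (real p / real q)\<rfloor> - \<lfloor>real n * (real p / real q)\<rfloor>) [1..<q - 1]"

lemma central_word_mechanical:
  assumes "0 < p" "p < q"
  shows "[0] @ central_word p q @ [1] =
    map (\<lambda>n. \<lfloor>real (n + 1) * (real p / real q)\<rfloor> - \<lfloor>real n * (real p / real q)\<rfloor>) [0..<q]"
proof -
  have q: "q \<ge> 2" using assms by simp
  have "[0..<q] = 0 # [1..<q]" using q by (simp add: upt_rec)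
  also have "[1..<q] = [1..<q - 1] @ [q - 1]"
    using q upt_Suc[of 1 "q - 1"] by simp
  finally have split: "[0..<q] = [0] @ [1..<q - 1] @ [q - 1]" by simp
  have first: "\<lfloor>real p / real q\<rfloor> = 0"
    using assms by (simp add: floor_eq_iff)
  have "real (q - 1) * (real p / real q) = real p - real p / real q"
    using q by (simp add: of_nat_diff field_simps)
  moreover have "\<lfloor>real p - real p / real q\<rfloor> = int p - 1"
    using assms by (simp add: floor_eq_iff)
  moreover have "real (q - 1 + 1) * (real p / real q) = real p"
    using q by simp
  ultimately have last:
    "\<lfloor>real (q - 1 + 1) * (real p / real q)\<rfloor> - \<lfloor>real (q - 1) * (real p / real q)\<rfloor> = 1"
    by simp
  show ?thesis
    unfolding split central_word_def using first last by simp
qed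

text \<open>The word \<open>\<cdots> u w\<^sub>-\<^sub>1 u w\<^sub>0 u w\<^sub>1 u \<cdots>\<close>, in which \<open>w\<^sub>0\<close> occupies the indices \<open>-1\<close> and \<open>0\<close>.\<close>

definition interleave :: "int list \<Rightarrow> (int \<Rightarrow> int list) \<Rightarrow> int \<Rightarrow> int" where
  "interleave u w n =
     (let q = int (length u + 2) in (w ((n + 1) div q) @ u) ! nat ((n + 1) mod q))"

definition swap_choice :: "(int \<Rightarrow> int list) \<Rightarrow> bool" where
  "swap_choice w \<longleftrightarrow> (\<forall>s. w s \<in> {[0, 1], [1, 0]})"

definition central_form :: "int list \<Rightarrow> (int \<Rightarrow> int) \<Rightarrow> bool" where
  "central_form u f \<longleftrightarrow> (\<exists>w. swap_choice w \<and> f = interleave u w)"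

text \<open>
  The bi-infinite word \<open>\<^sup>\<infinity>l x . y r\<^sup>\<infinity>\<close>: the finite words \<open>x\<close> and \<open>y\<close> end at index \<open>-1\<close> and start at
  index \<open>0\<close>, and are preceded and followed by copies of \<open>l\<close> and \<open>r\<close>.
\<close>

definition biword :: "int list \<Rightarrow> int list \<Rightarrow> int list \<Rightarrow> int list \<Rightarrow> int \<Rightarrow> int" where
  "biword l x y r n =
     (if n \<ge> int (length y) then r ! nat ((n - int (length y)) mod int (length r))
      else if n \<ge> 0 then y ! nat n
      else if n \<ge> - int (length x) then x ! nat (n + int (length x))
      else l ! nat ((n + int (length x)) mod int (length l)))"

definition case_free :: "int list \<Rightarrow> (int \<Rightarrow> int list) \<Rightarrow> lattice \<Rightarrow> bool" where
  "case_free u w L \<longleftrightarrow>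
     words L =
       (interleave u w,
        biword ([1] @ u @ [0]) [] [] ([1] @ u @ [0]),
        biword ([0] @ u @ [1]) [] [] ([0] @ u @ [1]))"

definition case_rigid :: "int list \<Rightarrow> lattice \<Rightarrow> bool" where
  "case_rigid u L \<longleftrightarrow>
     words L =
       (biword ([0] @ u @ [1]) [] ([0] @ u @ [0]) ([1] @ u @ [0]),
        biword ([0] @ u @ [1]) ([0] @ u @ [0]) [] ([1] @ u @ [0]),
        biword ([0] @ u @ [1]) ([0] @ u @ [0]) [] ([1] @ u @ [0])) \<or>
     words L =
       (biword ([1] @ u @ [0]) [] ([1] @ u @ [1]) ([0] @ u @ [1]),
        biword ([1] @ u @ [0]) ([1] @ u @ [1]) [] ([0] @ u @ [1]),
        biword ([1] @ u @ [0]) ([1] @ u @ [1]) [] ([0] @ u @ [1]))"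

end

theory Submission
  imports Defs "HOL-Number_Theory.Cong"
begin

text \<open>
  The index set \<open>V\<close> is the plane \<open>i + j + k = 0\<close>. Subtract from each sequence its linear part
  \<open>(\<kappa> + p / q) i\<close> and multiply by \<open>q\<close>: the result is an integer sequence congruent to \<open>- p i\<close>
  modulo \<open>q\<close>, and the three values at indices of sum \<open>0\<close> add up to one of two numbers differing by
  \<open>q\<close>. As the density excludes a drift, each sequence oscillates by at most \<open>q\<close>. Hence it is
  determined by its slope, except at one residue class of indices, where at each index either the
  lower or the upper end of the range may be chosen: this is the choice between \<open>01\<close> and \<open>10\<close>.
  After normalization the lattices correspond exactly to triples of binary sequences \<open>\<sigma>\<close>, \<open>\<tau>\<close>,
  \<open>\<rho>\<close> on the integers with \<open>\<sigma> s\<close>, \<open>\<tau> t\<close>, \<open>\<rho> r\<close> never all equal when \<open>s + t + r = 0\<close>. Either two of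
  these are opposite constants, which leaves the third one free, or all three are monotone steps in
  the same direction whose thresholds add up to \<open>1\<close> or \<open>2\<close>; reversal exchanges these two sums.
\<close>

section \<open>The index plane\<close>

lemma separated_less:
  assumes "separated f" "i < j"
  shows "f i < f j"
  using assms(2)
proof (induction j rule: int_gr_induct)
  case base
  then show ?case using assms(1) by (simp add: separated_def algebra_simps) (smt (verit))
next
  case (step j)
  moreover have "f (j + 1) - f j \<ge> 1" using assms(1) by (simp add: separated_def)
  ultimately show ?case by linarith
qed

lemma separated_less_iff:
  assumes "separated f"
  shows "f i < f j \<longleftrightarrow> i < j"
  using separated_less[OF assms] by (metis less_irrefl linorder_neqE order_less_trans)

text \<open>A value skipped between \<open>f j\<close> and \<open>f (j + 1)\<close> could only be
  taken at an index strictly between \<open>j\<close> and \<open>j + 1\<close>, so each step is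
  exactly -1.\<close>

lemma strict_antimono_bij_int:
  fixes f :: "int \<Rightarrow> int"
  assumes less: "\<And>j. f (j + 1) < f j" and "surj f"
  shows "f j = f 0 - j"
proof -
  have anti: "f k < f j" if "j < k" for j k
    using that by (induction k rule: int_gr_induct) (use less in \<open>auto intro: order_less_trans\<close>)
  have step: "f (j + 1) = f j - 1" for j
  proof (rule ccontr)
    assume "f (j + 1) \<noteq> f j - 1"
    with less[of j] have gap: "f (j + 1) < f j - 1" by linarith
    obtain k where k: "f k = f j - 1" using \<open>surj f\<close> by (metis surjD)
    have "k > j" using anti[of k j] k by (cases k j rule: linorder_cases) auto
    then have "k \<ge> j + 1" by simp
    then have "f k \<le> f (j + 1)" using anti[of "j + 1" k] by (cases "k = j + 1") auto
    with gap k show False by linarith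
  qed
  show ?thesis
  proof (induction j rule: int_induct[where k = 0])
    case (step2 i)
    then show ?case using step[of "i - 1"] by simp
  qed (use step in auto)
qed

text \<open>For fixed \<open>i\<close>, separation makes the third index strictly decreasing in \<open>j\<close>; being a
  bijection of the integers, it decreases by exactly \<open>1\<close> in each step. So \<open>V\<close> is the plane
  \<open>i + j + k = 0\<close>.\<close>

lemma sturmian_lattice_iff:
  "sturmian_lattice (a, b, c) \<longleftrightarrow>
     separated a \<and> separated b \<and> separated c \<and> (\<forall>i j. \<bar>a i + b j + c (- i - j)\<bar> = 1 / 2)"
    (is "?L \<longleftrightarrow> ?R")
proof
  assume ?L
  then obtain V where sep: "separated a" "separated b" "separated c"
    and V0: "(0, 0, 0) \<in> V"
    and Vk: "\<forall>i j. \<exists>!k. (i, j, k) \<in> V" and Vj: "\<forall>i k. \<exists>!j. (i, j, k) \<in> V"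
    and Vi: "\<forall>j k. \<exists>!i. (i, j, k) \<in> V"
    and half: "\<And>i j k. (i, j, k) \<in> V \<Longrightarrow> \<bar>a i + b j + c k\<bar> = 1 / 2"
    by auto
  define g where "g i j = (THE k. (i, j, k) \<in> V)" for i j
  have g: "(i, j, k) \<in> V \<longleftrightarrow> k = g i j" for i j k
    unfolding g_def using Vk by (metis the_equality)
  have g': "\<bar>a i + b j + c (g i j)\<bar> = 1 / 2" for i j
    using g half by blast
  have dj: "g i (j + 1) < g i j" for i j
  proof -
    have "b (j + 1) - b j \<ge> 1" using sep by (simp add: separated_def)
    \<comment> \<open>Two triple sums, each 1/2 or -1/2, differ by at most 1, so a gain of at least
      1 in \<open>b\<close> leaves no room for a gain in \<open>c\<close>.\<close>
    then have "c (g i (j + 1)) \<le> c (g i j)"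
      using g'[of i j] g'[of i "j + 1"] by linarith
    then have "g i (j + 1) \<le> g i j"
      using separated_less_iff[OF sep(3)] by (meson not_le)
    \<comment> \<open>Equality would complete the same first and third index by both
      \<open>j\<close> and \<open>j + 1\<close>.\<close>
    moreover have "g i (j + 1) \<noteq> g i j"
      using Vj g by (metis add_cancel_right_right zero_neq_one)
    ultimately show ?thesis by simp
  qed
  have di: "g (i + 1) j < g i j" for i j
  proof -
    have "a (i + 1) - a i \<ge> 1" using sep by (simp add: separated_def)
    then have "c (g (i + 1) j) \<le> c (g i j)"
      using g'[of i j] g'[of "i + 1" j] by linarith
    then have "g (i + 1) j \<le> g i j"
      using separated_less_iff[OF sep(3)] by (meson not_le)
    moreover have "g (i + 1) j \<noteq> g i j"
      using Vi g by (metis add_cancel_right_right zero_neq_one)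
    ultimately show ?thesis by simp
  qed
  have g1: "g i j = g i 0 - j" for i j
    using strict_antimono_bij_int[of "g i"] dj Vj g by (metis surjI)
  have g2: "g i 0 = g 0 0 - i" for i
    using strict_antimono_bij_int[of "\<lambda>i. g i 0"] di Vi g by (metis surjI)
  have g3: "g 0 0 = 0" using V0 g by metis
  have "g i j = - i - j" for i j
    using g1[of i j] g2[of i] g3 by linarith
  then show ?R using sep g' by metis
next
  assume R: ?R
  have third: "\<exists>!k. i + j + k = 0" "\<exists>!k. i + k + j = 0" "\<exists>!k. k + i + j = 0" for i j :: int
    by (rule ex1I[of _ "- i - j"]; simp)+
  moreover have "\<bar>a i + b j + c k\<bar> = 1 / 2" if "i + j + k = 0" for i j k
  proof -
    have "k = - i - j" using that by simp
    then show ?thesis using R by blast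
  qed
  ultimately show ?L using R third unfolding sturmian_lattice.simps
    by (intro conjI exI[of _ "{(i, j, k). i + j + k = 0}"]) auto
qed

section \<open>Triples of binary sequences without equal values\<close>

text \<open>The values mark the two ends of the range at multiples of \<open>q\<close>:
  \<open>True\<close> for \<open>q\<close>, \<open>False\<close> for 0. Three equal values would
  make the deviations add up to 0 or \<open>3 * q\<close> instead of \<open>q\<close> or
  \<open>2 * q\<close>.\<close>

definition never_equal :: "(int \<Rightarrow> bool) \<Rightarrow> (int \<Rightarrow> bool) \<Rightarrow> (int \<Rightarrow> bool) \<Rightarrow> bool" where
  "never_equal \<sigma> \<tau> \<rho> \<longleftrightarrow> (\<forall>s t. \<not> (\<sigma> s = \<tau> t \<and> \<tau> t = \<rho> (- s - t)))"

lemma never_equalD: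
  "never_equal \<sigma> \<tau> \<rho> \<Longrightarrow> s + t + r = 0 \<Longrightarrow> \<sigma> s = \<tau> t \<Longrightarrow> \<rho> r \<noteq> \<sigma> s"
  unfolding never_equal_def by (metis add_eq_0_iff diff_conv_add_uminus minus_add_distrib)

lemma never_equal_swap12: "never_equal \<sigma> \<tau> \<rho> \<Longrightarrow> never_equal \<tau> \<sigma> \<rho>"
  unfolding never_equal_def by (metis diff_conv_add_uminus add.commute)

lemma never_equal_swap23: "never_equal \<sigma> \<tau> \<rho> \<Longrightarrow> never_equal \<sigma> \<rho> \<tau>"
  unfolding never_equal_def
  by (metis (no_types, opaque_lifting) diff_conv_add_uminus minus_add_cancel minus_add_distrib minus_minus)

lemma never_equal_not: "never_equal \<sigma> \<tau> \<rho> \<Longrightarrow>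
  never_equal (\<lambda>s. \<not> \<sigma> s) (\<lambda>s. \<not> \<tau> s) (\<lambda>s. \<not> \<rho> s)"
  unfolding never_equal_def by blast

lemma never_equal_shift:
  assumes ne: "never_equal \<sigma> \<tau> \<rho>" and sum: "s + t + r = 0"
  shows "never_equal (\<lambda>n. \<sigma> (n + s)) (\<lambda>n. \<tau> (n + t)) (\<lambda>n. \<rho> (n + r))"
  unfolding never_equal_def
proof (intro allI)
  fix i j
  have "(i + s) + (j + t) + (- i - j + r) = 0" using sum by simp
  from never_equalD[OF ne this]
  show "\<not> (\<sigma> (i + s) = \<tau> (j + t) \<and> \<tau> (j + t) = \<rho> (- i - j + r))" by blast
qed

text \<open>This is the effect of \<open>reversed\<close>: indices change sign, and upper and lower
  ends trade places.\<close>

lemma never_equal_reflect: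
  assumes ne: "never_equal \<sigma> \<tau> \<rho>"
  shows "never_equal (\<lambda>s. \<not> \<sigma> (- s)) (\<lambda>s. \<not> \<tau> (- s)) (\<lambda>s. \<not> \<rho> (- s))"
  unfolding never_equal_def
proof (intro allI)
  fix s t :: int
  have "- s + - t + - (- s - t) = 0" by simp
  from never_equalD[OF ne this]
  show "\<not> ((\<not> \<sigma> (- s)) = (\<not> \<tau> (- t)) \<and> (\<not> \<tau> (- t)) = (\<not> \<rho> (- (- s - t))))" by blast
qed

lemma mono_step_or_const:
  fixes \<sigma> :: "int \<Rightarrow> bool"
  assumes mono: "\<And>s. \<sigma> s \<Longrightarrow> \<sigma> (s + 1)" and "\<sigma> s1" "\<not> \<sigma> s0"
  obtains t where "\<sigma> = (\<lambda>s. t \<le> s)"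
proof -
  have up: "\<sigma> s'" if "\<sigma> s" "s \<le> s'" for s s'
    using that(2,1) by (induction s' rule: int_ge_induct) (auto simp: mono)
  \<comment> \<open>The integers have no least element, so the search for the threshold starts at
    \<open>s0\<close>; upward closure keeps \<open>\<sigma>\<close> false at and below
    \<open>s0\<close>.\<close>
  define n where "n = (LEAST n. \<sigma> (s0 + int n))"
  have "\<sigma> (s0 + int (nat (s1 - s0)))"
    using up[OF \<open>\<sigma> s1\<close>] by simp
  then have n: "\<sigma> (s0 + int n)" unfolding n_def by (rule LeastI)
  have least: "\<not> \<sigma> s" if "s < s0 + int n" for s
  proof (cases "s \<le> s0")
    case True
    then show ?thesis using up \<open>\<not> \<sigma> s0\<close> by blast
  next
    case False
    then have "nat (s - s0) < n" using that by linarith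
    from not_less_Least[OF this[unfolded n_def]] False show ?thesis by simp
  qed
  have "\<sigma> = (\<lambda>s. s0 + int n \<le> s)"
    using up[OF n] least by (auto simp: not_le[symmetric])
  then show ?thesis by (rule that)
qed

text \<open>If \<open>\<tau>\<close> fell from \<open>t\<close> to \<open>t + 1\<close>, the pairs
  \<open>(s, t + 1)\<close> and \<open>(s + 1, t)\<close> would share the third index, where the
  first forces \<open>\<rho>\<close> to be true and the second forces it to be false.\<close>

lemma never_equal_rise:
  assumes ne: "never_equal \<sigma> \<tau> \<rho>" and "\<not> \<sigma> s" "\<sigma> (s + 1)" and "\<tau> t"
  shows "\<tau> (t + 1)"
proof (rule ccontr)
  assume "\<not> \<tau> (t + 1)"
  then show False
    using never_equalD[OF ne, of s "t + 1" "- s - t - 1"] never_equalD[OF ne, of "s + 1" t "- s - t - 1"]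
      assms by auto
qed

text \<open>A rise in one sequence forbids falls in the others, so \<open>\<tau>\<close> and
  \<open>\<rho>\<close> are steps; the rise of \<open>\<tau>\<close> then makes
  \<open>\<sigma>\<close> a step too.\<close>

lemma never_equal_up:
  assumes ne: "never_equal \<sigma> \<tau> \<rho>" and rise: "\<not> \<sigma> s" "\<sigma> (s + 1)"
    and nc: "\<tau> t1" "\<not> \<tau> t0" "\<rho> r1" "\<not> \<rho> r0"
  obtains x y z where "\<sigma> = (\<lambda>s. x \<le> s)" "\<tau> = (\<lambda>s. y \<le> s)" "\<rho> = (\<lambda>s. z \<le> s)"
    "x + y + z = 1 \<or> x + y + z = 2"
proof -
  obtain y where y: "\<tau> = (\<lambda>s. y \<le> s)"
    using mono_step_or_const[of \<tau>] never_equal_rise[OF ne rise] nc by metis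
  obtain z where z: "\<rho> = (\<lambda>s. z \<le> s)"
    using mono_step_or_const[of \<rho>] never_equal_rise[OF never_equal_swap23[OF ne] rise] nc by metis
  have "\<not> \<tau> (y - 1)" "\<tau> (y - 1 + 1)" using y by auto
  from never_equal_rise[OF never_equal_swap12[OF ne] this]
  obtain x where x: "\<sigma> = (\<lambda>s. x \<le> s)"
    using mono_step_or_const[of \<sigma>] rise by metis
  \<comment> \<open>With a threshold sum of at most 0, all three are true at \<open>x\<close>,
    \<open>y\<close>, \<open>- x - y\<close>; with a sum of at least 3, all three are false at
    \<open>x - 1\<close>, \<open>y - 1\<close>, \<open>2 - x - y\<close>.\<close>
  have "x + y + z \<noteq> k" if "k \<le> 0" for k
    using never_equalD[OF ne, of x y "- x - y"] x y z that by auto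
  moreover have "x + y + z \<noteq> k" if "k \<ge> 3" for k
    using never_equalD[OF ne, of "x - 1" "y - 1" "2 - x - y"] x y z that by auto
  ultimately have "\<not> x + y + z \<le> 0" "\<not> x + y + z \<ge> 3" by blast+
  then have "x + y + z = 1 \<or> x + y + z = 2" by linarith
  then show ?thesis using that x y z by blast
qed

text \<open>A nonconstant sequence without a rise has a fall, and negating all three sequences turns
  the fall into a rise.\<close>

lemma never_equal_cases:
  assumes ne: "never_equal \<sigma> \<tau> \<rho>"
    and nc: "\<sigma> s1" "\<not> \<sigma> s0" "\<tau> t1" "\<not> \<tau> t0" "\<rho> r1" "\<not> \<rho> r0"
  obtains (up) x y z where "\<sigma> = (\<lambda>s. x \<le> s)" "\<tau> = (\<lambda>s. y \<le> s)" "\<rho> = (\<lambda>s. z \<le> s)"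
      "x + y + z = 1 \<or> x + y + z = 2"
    | (down) x y z where "\<sigma> = (\<lambda>s. s < x)" "\<tau> = (\<lambda>s. s < y)" "\<rho> = (\<lambda>s. s < z)"
      "x + y + z = 1 \<or> x + y + z = 2"
proof (cases "\<exists>s. \<not> \<sigma> s \<and> \<sigma> (s + 1)")
  case True
  then show ?thesis using never_equal_up[OF ne] nc up by metis
next
  case False
  have "\<exists>s. \<sigma> s \<and> \<not> \<sigma> (s + 1)"
  proof (rule ccontr)
    assume "\<not> ?thesis"
    then obtain t where "\<sigma> = (\<lambda>s. t \<le> s)" using mono_step_or_const[of \<sigma>] nc by metis
    then show False using not_ex[THEN iffD1, OF False, THEN spec, of "t - 1"] by simp
  qed
  then obtain s where "\<not> \<not> \<sigma> s" "\<not> \<sigma> (s + 1)" by blast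
  from never_equal_up[OF never_equal_not[OF ne], simplified, OF this[simplified] nc(4,3,6,5)]
  obtain x y z where "(\<lambda>s. \<not> \<sigma> s) = (\<lambda>s. x \<le> s)" "(\<lambda>s. \<not> \<tau> s) = (\<lambda>s. y \<le> s)"
    "(\<lambda>s. \<not> \<rho> s) = (\<lambda>s. z \<le> s)" and sum: "x + y + z = 1 \<or> x + y + z = 2" by metis
  then have "\<sigma> = (\<lambda>s. s < x)" "\<tau> = (\<lambda>s. s < y)" "\<rho> = (\<lambda>s. s < z)"
    by (auto simp: fun_eq_iff not_le[symmetric])
  then show ?thesis using sum down by blast
qed

text \<open>If both other sequences took the value \<open>x\<close>, at \<open>t\<close> and
  \<open>r\<close> say, the constant one would complete an equal triple at
  \<open>- t - r\<close>.\<close>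

lemma never_equal_const:
  assumes ne: "never_equal (\<lambda>_. x) \<tau> \<rho>"
  shows "\<tau> = (\<lambda>_. \<not> x) \<or> \<rho> = (\<lambda>_. \<not> x)"
proof (rule ccontr)
  assume "\<not> ?thesis"
  then obtain t r where "\<tau> t = x" "\<rho> r = x" by (auto simp: fun_eq_iff)
  then show False using never_equalD[OF ne, of "- t - r" t r] by simp
qed

section \<open>Words and lattices of rational slope\<close>

locale rational_slope =
  fixes p q :: nat
  assumes p_pos: "0 < p" and p_less_q: "p < q" and coprime: "coprime p q"
begin

lemma q_ge_2: "2 \<le> q"
  using p_pos p_less_q by simp

lemma dvd_mult_p_iff: "int q dvd int p * r \<longleftrightarrow> int q dvd r"
  using coprime by (simp add: coprime_dvd_mult_right_iff coprime_commute)

text \<open>The values \<open>0\<close> and \<open>q\<close> agree modulo \<open>q\<close>: at multiples of \<open>q\<close> the deviation of a word from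
  its slope is free to take either of them, and it is determined everywhere else.\<close>

definition dev :: "(int \<Rightarrow> bool) \<Rightarrow> int \<Rightarrow> int" where
  "dev \<sigma> i = (if int q dvd i then (if \<sigma> (i div int q) then int q else 0)
               else (- int p * i) mod int q)"

text \<open>The deviation gains \<open>q - p\<close> at a letter 1 and loses \<open>p\<close> at a
  letter 0. Around a multiple of \<open>q\<close> it runs from \<open>p\<close> to
  \<open>q - p\<close>, through \<open>q\<close> for the pair \<open>10\<close> and through 0 for
  \<open>01\<close>.\<close>

definition word :: "(int \<Rightarrow> bool) \<Rightarrow> int \<Rightarrow> int" where
  "word \<sigma> = interleave (central_word p q) (\<lambda>s. if \<sigma> s then [1, 0] else [0, 1])"

text \<open>The three offsets -1/2 turn deviation sums \<open>q\<close> and \<open>2 * q\<close>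
  into position sums -1/2 and 1/2.\<close>

definition pos :: "real \<Rightarrow> (int \<Rightarrow> bool) \<Rightarrow> int \<Rightarrow> real" where
  "pos \<kappa> \<sigma> i =
     \<kappa> * real_of_int i + real_of_int (dev \<sigma> i + int p * i) / real q - 1 / 2"

definition lattice_of :: "real \<Rightarrow> (int \<Rightarrow> bool) \<Rightarrow> (int \<Rightarrow> bool) \<Rightarrow> (int \<Rightarrow> bool) \<Rightarrow> lattice" where
  "lattice_of \<kappa> \<sigma> \<tau> \<rho> = (pos \<kappa> \<sigma>, pos \<kappa> \<tau>, pos \<kappa> \<rho>)"

section \<open>Deviations: range, residues and symmetries\<close>

lemma dev_bounds: "0 \<le> dev \<sigma> i" "dev \<sigma> i \<le> int q"
  using q_ge_2 by (auto simp: dev_def order_less_imp_le)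

lemma dev_dvd: "int q dvd dev \<sigma> i + int p * i"
proof -
  have "((- int p * i) mod int q + int p * i) mod int q = 0"
    by (simp add: mod_add_left_eq)
  then show ?thesis by (auto simp: dev_def mod_eq_0_iff_dvd)
qed

lemma dev_nonspecial:
  assumes "\<not> int q dvd i"
  shows "0 < dev \<sigma> i" "dev \<sigma> i < int q"
proof -
  have "(- int p * i) mod int q \<noteq> 0"
    using assms dvd_mult_p_iff[of i] by (simp add: mod_eq_0_iff_dvd)
  moreover have "0 \<le> (- int p * i) mod int q" "(- int p * i) mod int q < int q"
    using q_ge_2 by simp_all
  moreover have "dev \<sigma> i = (- int p * i) mod int q" using assms by (simp add: dev_def)
  ultimately show "0 < dev \<sigma> i" "dev \<sigma> i < int q" by linarith+
qed

text \<open>A residue modulo \<open>q\<close> determines a number in the range from 0 to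
  \<open>q\<close> unless the residue is 0, which by coprimality happens only at multiples of
  \<open>q\<close>; there \<open>\<sigma>\<close> records which end is taken.\<close>

lemma dev_unique:
  assumes bounds: "\<And>i. 0 \<le> f i" "\<And>i. f i \<le> int q" and dvd: "\<And>i. int q dvd f i + int p * i"
  shows "f = dev (\<lambda>s. f (int q * s) = int q)"
proof
  fix i
  show "f i = dev (\<lambda>s. f (int q * s) = int q) i"
  proof (cases "int q dvd i")
    case True
    then obtain s where s: "i = int q * s" by blast
    have "int q dvd f i"
      using dvd[of i] s by (metis dvd_add_left_iff dvd_mult dvd_triv_left)
    then obtain k where k: "f i = int q * k" by blast
    have "k = 0 \<or> k = 1"
      using bounds[of i] q_ge_2 unfolding k
      by (auto simp: zero_le_mult_iff mult_le_cancel_left2)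
    then show ?thesis using q_ge_2 s k by (auto simp: dev_def)
  next
    case False
    have eq: "f i mod int q = (- int p * i) mod int q"
      using dvd[of i] by (simp add: mod_eq_dvd_iff)
    have "f i \<noteq> int q"
      using False dvd[of i] dvd_mult_p_iff[of i] by auto
    then have "f i mod int q = f i" using bounds[of i] by (simp add: less_le)
    then show ?thesis using False eq by (simp add: dev_def)
  qed
qed

lemma dev_shift: "dev (\<lambda>t. \<sigma> (t + s)) i = dev \<sigma> (i + int q * s)"
proof -
  have "- int p * (i + int q * s) = - int p * i + int q * (- int p * s)"
    by (simp add: algebra_simps)
  then have "(- int p * (i + int q * s)) mod int q = (- int p * i) mod int q"
    by (simp only: mod_mult_self2)
  moreover have "int q dvd i + int q * s \<longleftrightarrow> int q dvd i"
    by (simp add: dvd_add_left_iff)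
  ultimately show ?thesis using q_ge_2 by (auto simp: dev_def add.commute)
qed

text \<open>A nonzero residue \<open>m\<close> becomes \<open>q - m\<close> under negation; at
  multiples of \<open>q\<close> the two ends are exchanged, hence the negation of
  \<open>\<sigma>\<close>.\<close>

lemma dev_minus: "dev \<sigma> (- i) = int q - dev (\<lambda>s. \<not> \<sigma> (- s)) i"
proof (cases "int q dvd i")
  case True
  then show ?thesis using q_ge_2 by (auto simp: dev_def dvd_neg_div)
next
  case False
  then have "\<not> int q dvd int p * i" using dvd_mult_p_iff by simp
  then show ?thesis using False q_ge_2
    by (simp add: dev_def zmod_zminus1_eq_if mod_eq_0_iff_dvd)
qed

section \<open>Words cut into blocks of length \<open>q\<close>\<close>

lemma length_central_word: "length (central_word p q) = q - 2"
  by (simp add: central_word_def)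

lemma central_word_nth:
  assumes "k < q - 2"
  shows "central_word p q ! k = (int p * (int k + 2)) div int q - (int p * (int k + 1)) div int q"
proof -
  have fl: "\<lfloor>real n * (real p / real q)\<rfloor> = (int p * int n) div int q" for n
    using floor_divide_of_int_eq[of "int p * int n" "int q", where ?'a = real]
    by (simp add: mult.commute)
  have "[1..<q - 1] ! k = k + 1" using assms by simp
  then show ?thesis
    using assms fl[of "k + 2"] fl[of "k + 1"]
    by (simp add: central_word_def nth_map add.commute del: upt_Suc)
qed

text \<open>\<open>interleave\<close> puts the second letter of the pair number \<open>t\<close> at
  index \<open>int q * t\<close>. Blocks aligned at multiples of \<open>q\<close> therefore cut each
  pair in the middle, and their outer letters come from two consecutive pairs.\<close>

lemma word_block:
  assumes "0 \<le> r" "r < int q"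
  shows "word \<sigma> (int q * t + r) =
    ([if \<sigma> t then 0 else 1] @ central_word p q @ [if \<sigma> (t + 1) then 1 else 0]) ! nat r"
proof -
  let ?u = "central_word p q"
  have q: "int (length ?u + 2) = int q" using length_central_word q_ge_2 by simp
  show ?thesis
  proof (cases "r = int q - 1")
    case True
    have "int q * t + r + 1 = int q * (t + 1)" using True by (simp add: algebra_simps)
    then have "(int q * t + r + 1) div int q = t + 1" "(int q * t + r + 1) mod int q = 0"
      using q_ge_2 by simp_all
    moreover have "nat r = Suc (q - 2)" using True q_ge_2 by simp
    ultimately show ?thesis
      unfolding word_def interleave_def Let_def q
      by (simp add: nth_append length_central_word)
  next
    case False
    have eq: "int q * t + r + 1 = r + 1 + int q * t" by simp
    have "(int q * t + r + 1) div int q = t" "(int q * t + r + 1) mod int q = r + 1"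
      unfolding eq using False assms q_ge_2 by simp_all
    moreover have "nat (r + 1) = Suc (nat r)" using assms by simp
    moreover have "nat r < q - 1" using assms False by linarith
    ultimately show ?thesis
      unfolding word_def interleave_def Let_def q using q_ge_2
      by (cases "nat r") (auto simp: nth_append length_central_word)
  qed
qed

lemma dev_block:
  assumes "0 < r" "r < int q"
  shows "dev \<sigma> (int q * t + r) = int q - int p * r + int q * ((int p * r) div int q)"
proof -
  have "\<not> int q dvd r" using assms zdvd_not_zless by blast
  then have ndvd: "\<not> int q dvd int p * r" using dvd_mult_p_iff by simp
  have eq: "- int p * (int q * t + r) = - (int p * r) + int q * (- int p * t)"
    by (simp add: algebra_simps)
  have "\<not> int q dvd int q * t + r"
    using \<open>\<not> int q dvd r\<close> by (simp add: dvd_add_right_iff)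
  then have "dev \<sigma> (int q * t + r) = (- (int p * r) + int q * (- int p * t)) mod int q"
    unfolding dev_def eq by (simp only: if_False)
  also have "\<dots> = (- (int p * r)) mod int q" by (simp only: mod_mult_self2)
  also have "\<dots> = int q - (int p * r) mod int q"
    using ndvd by (simp add: zmod_zminus1_eq_if mod_eq_0_iff_dvd)
  finally show ?thesis by (simp add: minus_mult_div_eq_mod[symmetric])
qed

lemma dev_multiple: "dev \<sigma> (int q * t) = (if \<sigma> t then int q else 0)"
  using q_ge_2 by (simp add: dev_def)

text \<open>Inside a block both sides are differences of the same integer quotients; at its ends the
  values \<open>p\<close> and \<open>q - p\<close> meet the freely chosen value 0 or
  \<open>q\<close>.\<close>

lemma word_dev: "int q * word \<sigma> n = dev \<sigma> (n + 1) - dev \<sigma> n + int p"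
proof -
  define t r where "t = n div int q" and "r = n mod int q"
  have n: "n = int q * t + r" and r: "0 \<le> r" "r < int q"
    using q_ge_2 by (simp_all add: t_def r_def)
  have small: "int p div int q = 0" using p_less_q by simp
  have last: "(int p * (int q - 1)) div int q = int p - 1"
  proof -
    have "int p * (int q - 1) = (int q - int p) + int q * (int p - 1)"
      by (simp add: algebra_simps)
    then show ?thesis using p_pos p_less_q by simp
  qed
  \<comment> \<open>Offset 0 leaves a multiple of \<open>q\<close>, offset \<open>int q - 1\<close>
    enters the next one, and the rest is the central word. The first case would need
    \<open>q = 1\<close>.\<close>
  consider "r = 0" "r = int q - 1" | "r = 0" "r < int q - 1" | "0 < r" "r < int q - 1"
    | "0 < r" "r = int q - 1"
    using r by linarith
  then show ?thesis
  proof cases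
    case 1
    then show ?thesis using q_ge_2 by simp
  next
    case 2
    then show ?thesis
      using word_block[OF r, of \<sigma> t] dev_multiple[of \<sigma> t] dev_block[of 1 \<sigma> t] small n by simp
  next
    case 3
    then have k: "nat r - 1 < q - 2" by linarith
    have ir: "int (nat r - 1) = r - 1" using 3 by simp
    have "word \<sigma> n = central_word p q ! (nat r - 1)"
      using word_block[OF r, of \<sigma> t] n 3 k by (simp add: nth_append length_central_word nth_Cons')
    also have "\<dots> = (int p * (r + 1)) div int q - (int p * r) div int q"
      using central_word_nth[OF k] ir by (simp add: add.commute)
    finally show ?thesis
      using dev_block[of r \<sigma> t] dev_block[of "r + 1" \<sigma> t] 3 unfolding n
      by (simp add: right_diff_distrib distrib_left add.assoc)
  next
    case 4
    have "n + 1 = int q * (t + 1)" using n 4 by (simp add: algebra_simps)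
    moreover have "dev \<sigma> n = int p"
      using dev_block[OF 4(1) r(2), of \<sigma> t] last unfolding n 4(2)
      by (simp only:) (simp add: right_diff_distrib)
    moreover have "nat r = Suc (q - 2)" using 4 q_ge_2 by simp
    then have "word \<sigma> n = (if \<sigma> (t + 1) then 1 else 0)"
      using word_block[OF r, of \<sigma> t] n by (simp add: nth_append length_central_word)
    ultimately show ?thesis using dev_multiple[of \<sigma> "t + 1"] by simp
  qed
qed

lemma word_01: "word \<sigma> n = 0 \<or> word \<sigma> n = 1"
proof -
  have "int q * word \<sigma> n < int q * 2" "int q * (-1) < int q * word \<sigma> n"
    using dev_bounds[of \<sigma> n] dev_bounds[of \<sigma> "n + 1"] p_pos p_less_q
    by (simp_all add: word_dev)
  then have "word \<sigma> n < 2" "-1 < word \<sigma> n"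
    using q_ge_2 by (auto simp only: mult_less_cancel_left_pos of_nat_0_less_iff)
  then show ?thesis by linarith
qed

lemma word_multiple: "word \<sigma> (int q * t) = (if \<sigma> t then 0 else 1)"
  using word_block[of 0 \<sigma> t] q_ge_2 by simp

lemma word_before_multiple: "word \<sigma> (int q * t - 1) = (if \<sigma> t then 1 else 0)"
proof -
  have "nat (int q - 1) = Suc (q - 2)" using q_ge_2 by simp
  then show ?thesis
    using word_block[of "int q - 1" \<sigma> "t - 1"] q_ge_2
    by (simp add: nth_append length_central_word algebra_simps)
qed

text \<open>A shift of the word by \<open>q\<close> is a shift of \<open>\<sigma>\<close> by 1. This
  criterion later keeps the free and the rigid case apart.\<close>

lemma word_periodic_iff: "(\<forall>n. word \<sigma> (n + int q) = word \<sigma> n) \<longleftrightarrow> (\<forall>t. \<sigma> t = \<sigma> 0)"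
proof (rule iffI; rule allI)
  fix t
  assume per: "\<forall>n. word \<sigma> (n + int q) = word \<sigma> n"
  have step: "\<sigma> (t + 1) = \<sigma> t" for t
    using per[rule_format, of "int q * t"] word_multiple[of \<sigma> t] word_multiple[of \<sigma> "t + 1"]
    by (simp add: distrib_left split: if_splits)
  show "\<sigma> t = \<sigma> 0"
  proof (induction t rule: int_induct[where k = 0])
    case (step1 i)
    then show ?case by (simp only: step)
  next
    case (step2 i)
    then show ?case using step[of "i - 1"] by simp
  qed simp
next
  fix n
  assume const: "\<forall>t. \<sigma> t = \<sigma> 0"
  have "(\<lambda>t. \<sigma> (t + 1)) = \<sigma>"
  proof
    fix t
    show "\<sigma> (t + 1) = \<sigma> t"
      by (rule trans[OF spec[OF const] sym[OF spec[OF const]]])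
  qed
  then have shift: "dev \<sigma> (i + int q) = dev \<sigma> i" for i
    using dev_shift[of \<sigma> 1 i] by simp
  have "int q * word \<sigma> (n + int q) = int q * word \<sigma> n"
    using shift[of n] shift[of "n + 1"] by (simp add: word_dev ac_simps)
  then show "word \<sigma> (n + int q) = word \<sigma> n" using q_ge_2 by simp
qed

end

section \<open>Density and absence of drift\<close>

lemma sum_telescope_int:
  fixes g :: "int \<Rightarrow> int"
  assumes "a \<le> b"
  shows "(\<Sum>i = a..<b. g (i + 1) - g i) = g b - g a"
  using assms
proof (induction b rule: int_ge_induct)
  case (step b)
  then have "{a..<b + 1} = insert b {a..<b}" by auto
  then show ?case using step by simp
qed simp

text \<open>Telescoping shows that the mean of \<open>f\<close> misses \<open>p / q\<close> by the
  symmetric difference quotient of \<open>X\<close>, divided by \<open>q\<close>.\<close>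

lemma has_density_iff:
  fixes X :: "int \<Rightarrow> int"
  assumes q: "0 < q" and f: "\<And>i. int q * f i = X (i + 1) - X i + int p"
  shows "has_density f (real p / real q) \<longleftrightarrow>
    (\<lambda>n. real_of_int (X (int n) - X (- int n)) / real (2 * n)) \<longlonglongrightarrow> 0"
proof -
  let ?S = "\<lambda>n. real_of_int (\<Sum>i = - int n..<int n. f i) / real (2 * n)"
  let ?D = "\<lambda>n. real_of_int (X (int n) - X (- int n)) / real (2 * n)"
  have sum: "int q * (\<Sum>i = - int n..<int n. f i) = X (int n) - X (- int n) + 2 * int n * int p" for n
  proof -
    have "int q * (\<Sum>i = - int n..<int n. f i) = (\<Sum>i = - int n..<int n. (X (i + 1) - X i) + int p)"
      by (simp add: sum_distrib_left f)
    also have "\<dots> = X (int n) - X (- int n) + 2 * int n * int p"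
      unfolding sum.distrib by (subst sum_telescope_int) auto
    finally show ?thesis .
  qed
  \<comment> \<open>At \<open>n = 0\<close> both quotients are 0 by convention and the equation can
    fail; the limit ignores this term.\<close>
  have eq: "?S n - real p / real q = ?D n * (1 / real q)" if "n > 0" for n
  proof -
    have "real q * real_of_int (\<Sum>i = - int n..<int n. f i) =
        real_of_int (X (int n) - X (- int n)) + 2 * real n * real p"
      using arg_cong[OF sum[of n], of real_of_int] by simp
    then have S: "real_of_int (\<Sum>i = - int n..<int n. f i) =
        (real_of_int (X (int n) - X (- int n)) + 2 * real n * real p) / real q"
      using q by (simp add: field_simps)
    show ?thesis unfolding S using q that by (simp add: field_simps)
  qed
  have "has_density f (real p / real q) \<longleftrightarrow> (\<lambda>n. ?S n - real p / real q) \<longlonglongrightarrow> 0"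
    unfolding has_density_def by (rule LIM_zero_iff[symmetric])
  also have "\<dots> \<longleftrightarrow> (\<lambda>n. ?D n * (1 / real q)) \<longlonglongrightarrow> 0"
    by (rule tendsto_cong) (use eq in \<open>auto intro!: eventually_sequentiallyI[of 1]\<close>)
  also have "\<dots> \<longleftrightarrow> ?D \<longlonglongrightarrow> 0"
    using q tendsto_mult_right_iff[of "1 / real q" ?D 0 sequentially] by simp
  finally show ?thesis .
qed

text \<open>An integer sequence that increases over every \<open>m\<close> steps gains at least
  \<open>2 * N\<close> between \<open>- m * N\<close> and \<open>m * N\<close>, so along the
  multiples of \<open>m\<close> the quotient stays at least \<open>1 / m\<close>.\<close>

lemma no_upward_drift:
  fixes X :: "int \<Rightarrow> int"
  assumes lim: "(\<lambda>n. real_of_int (X (int n) - X (- int n)) / real (2 * n)) \<longlonglongrightarrow> 0"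
    and m: "0 < m" and up: "\<And>i. X i < X (i + m)"
  shows False
proof -
  let ?D = "\<lambda>n. real_of_int (X (int n) - X (- int n)) / real (2 * n)"
  define k where "k = nat m"
  have k: "int k = m" "0 < k" using m by (simp_all add: k_def)
  have grow: "X i + int N \<le> X (i + m * int N)" for i N
  proof (induction N)
    case (Suc N)
    then show ?case using up[of "i + m * int N"] by (simp add: algebra_simps)
  qed simp
  have "1 / real k \<le> ?D (k * N)" if "N \<ge> 1" for N
  proof -
    have "X (- int (k * N)) + 2 * int N \<le> X (int (k * N))"
      using grow[of "- (m * int N)" "2 * N"] k(1) by (simp add: algebra_simps)
    then have "real_of_int (2 * int N) \<le> real_of_int (X (int (k * N)) - X (- int (k * N)))"
      unfolding of_int_le_iff by linarith
    then have "real_of_int (2 * int N) / real (2 * (k * N)) \<le> ?D (k * N)"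
      by (rule divide_right_mono) simp
    then show ?thesis using that k by simp
  qed
  moreover have "strict_mono (\<lambda>N. k * N)" using k by (simp add: strict_mono_def)
  from LIMSEQ_subseq_LIMSEQ[OF lim this] have "(\<lambda>N. ?D (k * N)) \<longlonglongrightarrow> 0"
    by (simp add: o_def)
  ultimately have "1 / real k \<le> 0" by (meson LIMSEQ_le_const)
  then show False using k by (simp add: zero_le_divide_iff field_simps)
qed

lemma no_downward_drift:
  fixes X :: "int \<Rightarrow> int"
  assumes lim: "(\<lambda>n. real_of_int (X (int n) - X (- int n)) / real (2 * n)) \<longlonglongrightarrow> 0"
    and m: "0 < m" and down: "\<And>i. X (i + m) < X i"
  shows False
proof (rule no_upward_drift[of "\<lambda>i. - X i"])
  have "(\<lambda>n. - (real_of_int (X (int n) - X (- int n)) / real (2 * n))) \<longlonglongrightarrow> 0"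
    using tendsto_minus[OF lim] by simp
  then show "(\<lambda>n. real_of_int (- X (int n) - - X (- int n)) / real (2 * n)) \<longlonglongrightarrow> 0"
    by (simp add: minus_divide_left)
qed (use m down in auto)

section \<open>Lattices built from binary sequences\<close>

context rational_slope
begin

lemma has_density_word: "has_density (word \<sigma>) (real p / real q)"
proof (subst has_density_iff[of q _ "dev \<sigma>"])
  have "norm (real_of_int (dev \<sigma> (int n) - dev \<sigma> (- int n)) / real (2 * n))
      \<le> norm (real q / real n) * 1" for n
  proof -
    have "\<bar>dev \<sigma> (int n) - dev \<sigma> (- int n)\<bar> \<le> int q"
      using dev_bounds[of \<sigma> "int n"] dev_bounds[of \<sigma> "- int n"] by linarith
    then have "real_of_int \<bar>dev \<sigma> (int n) - dev \<sigma> (- int n)\<bar> \<le> real q" by linarith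
    then show ?thesis by (simp add: divide_simps)
  qed
  then show "(\<lambda>n. real_of_int (dev \<sigma> (int n) - dev \<sigma> (- int n)) / real (2 * n)) \<longlonglongrightarrow> 0"
    by (intro tendsto_0_le[OF lim_const_over_n[of "real q"]] always_eventually) blast
qed (use q_ge_2 in \<open>auto simp: word_dev\<close>)

lemma pos_step: "pos \<kappa> \<sigma> (i + 1) - pos \<kappa> \<sigma> i = \<kappa> + real_of_int (word \<sigma> i)"
proof -
  have "real q * real_of_int (word \<sigma> i) = real_of_int (dev \<sigma> (i + 1) - dev \<sigma> i + int p)"
    by (metis of_int_mult of_int_of_nat_eq word_dev)
  then have "real_of_int (word \<sigma> i) = real_of_int (dev \<sigma> (i + 1) - dev \<sigma> i + int p) / real q"
    using q_ge_2 by (simp add: field_simps)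
  then show ?thesis by (simp add: pos_def diff_divide_distrib add_divide_distrib distrib_left)
qed

lemma color_word_pos: "color_word \<kappa> (pos \<kappa> \<sigma>) = word \<sigma>"
proof
  fix n
  show "color_word \<kappa> (pos \<kappa> \<sigma>) n = word \<sigma> n"
    using word_01[of \<sigma> n] by (auto simp: color_word_def pos_step)
qed

lemma range_pos_step: "range (\<lambda>i. pos \<kappa> \<sigma> (i + 1) - pos \<kappa> \<sigma> i) = {\<kappa>, \<kappa> + 1}"
proof -
  \<comment> \<open>The pair at the origin is \<open>01\<close> or \<open>10\<close>, so it alone
    shows both letters.\<close>
  have "{word \<sigma> (int q * 0), word \<sigma> (int q * 0 - 1)} = {0, 1}"
    unfolding word_multiple word_before_multiple by auto
  then have "range (word \<sigma>) = {0, 1}"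
    using word_01[of \<sigma>] by blast
  moreover have "range (\<lambda>i. pos \<kappa> \<sigma> (i + 1) - pos \<kappa> \<sigma> i) = (\<lambda>x. \<kappa> + real_of_int x) ` range (word \<sigma>)"
    by (simp add: pos_step image_image)
  ultimately show ?thesis by simp
qed

lemma widths_lattice_of: "widths (lattice_of \<kappa> \<sigma> \<tau> \<rho>) = {\<kappa>, \<kappa> + 1}"
  unfolding lattice_of_def widths.simps range_pos_step by simp

lemma min_width_lattice_of: "min_width (lattice_of \<kappa> \<sigma> \<tau> \<rho>) = \<kappa>"
  unfolding min_width_def widths_lattice_of by simp

lemma two_color_lattice_of: "two_color (lattice_of \<kappa> \<sigma> \<tau> \<rho>)"
  unfolding two_color_def widths_lattice_of by (simp add: card_insert_if)

lemma words_lattice_of: "words (lattice_of \<kappa> \<sigma> \<tau> \<rho>) = (word \<sigma>, word \<tau>, word \<rho>)"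
  using min_width_lattice_of[of \<kappa> \<sigma> \<tau> \<rho>] by (simp add: lattice_of_def Let_def color_word_pos)

lemma has_slope_lattice_of: "has_slope (lattice_of \<kappa> \<sigma> \<tau> \<rho>) (real p / real q)"
  unfolding has_slope_def words_lattice_of by (simp add: has_density_word)

lemma separated_pos: "1 \<le> \<kappa> \<Longrightarrow> separated (pos \<kappa> \<sigma>)"
  unfolding separated_def pos_step using word_01[of \<sigma>]
  by (metis add_increasing2 of_int_0 of_int_1 order_refl zero_le_one)

text \<open>The sum is a multiple of \<open>q\<close>, so it suffices to place it strictly between 0
  and \<open>3 * q\<close>. At multiples of \<open>q\<close> this is \<open>never_equal\<close>;
  otherwise one deviation lies strictly inside the range.\<close>

lemma dev_sum:
  assumes ne: "never_equal \<sigma> \<tau> \<rho>" and sum: "i + j + k = 0"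
  shows "dev \<sigma> i + dev \<tau> j + dev \<rho> k \<in> {int q, 2 * int q}"
proof -
  let ?T = "dev \<sigma> i + dev \<tau> j + dev \<rho> k"
  have k: "k = - i - j" using sum by simp
  have "?T = (dev \<sigma> i + int p * i) + (dev \<tau> j + int p * j) + (dev \<rho> k + int p * k)"
    unfolding k by (simp add: algebra_simps)
  then have "int q dvd ?T"
    using dev_dvd[of \<sigma> i] dev_dvd[of \<tau> j] dev_dvd[of \<rho> k] by (metis dvd_add)
  then obtain m where m: "?T = int q * m" by blast
  have "0 < ?T \<and> ?T < 3 * int q"
  proof (cases "int q dvd i \<and> int q dvd j")
    case True
    then obtain s t where s: "i = int q * s" and t: "j = int q * t" by blast
    have k': "- i - j = int q * (- s - t)" using s t by (simp add: algebra_simps)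
    show ?thesis
      using never_equalD[OF ne, of s t "- s - t"] q_ge_2 unfolding k k' unfolding s t dev_multiple by auto
  next
    case False
    then show ?thesis
      using dev_bounds[of \<sigma> i] dev_bounds[of \<tau> j] dev_bounds[of \<rho> k]
        dev_nonspecial[of i \<sigma>] dev_nonspecial[of j \<tau>] by auto
  qed
  then have "0 < m" "m < 3"
    using q_ge_2 unfolding m by (simp_all add: zero_less_mult_iff mult.commute)
  then have "m = 1 \<or> m = 2" by linarith
  then show ?thesis using m by auto
qed

lemma never_equal_if_dev_sum:
  assumes "\<And>i j. dev \<sigma> i + dev \<tau> j + dev \<rho> (- i - j) \<in> {int q, 2 * int q}"
  shows "never_equal \<sigma> \<tau> \<rho>"
  unfolding never_equal_def
proof (intro allI)
  fix s t
  have eq: "- (int q * s) - int q * t = int q * (- s - t)" by (simp add: algebra_simps)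
  show "\<not> (\<sigma> s = \<tau> t \<and> \<tau> t = \<rho> (- s - t))"
    using assms[of "int q * s" "int q * t"] q_ge_2 unfolding eq dev_multiple
    by (auto split: if_splits)
qed

lemma pos_sum:
  assumes "i + j + k = 0"
  shows "pos \<kappa> \<sigma> i + pos \<kappa> \<tau> j + pos \<kappa> \<rho> k =
    real_of_int (dev \<sigma> i + dev \<tau> j + dev \<rho> k) / real q - 3 / 2"
proof -
  have k: "k = - i - j" using assms by simp
  show ?thesis unfolding pos_def k using q_ge_2 by (simp add: field_simps)
qed

lemma sturmian_lattice_of:
  assumes "never_equal \<sigma> \<tau> \<rho>" and "1 \<le> \<kappa>"
  shows "sturmian_lattice (lattice_of \<kappa> \<sigma> \<tau> \<rho>)"
  unfolding lattice_of_def sturmian_lattice_iff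
proof (intro conjI allI separated_pos assms)
  fix i j :: int
  have "i + j + (- i - j) = 0" by simp
  note sum = pos_sum[OF this, of \<kappa> \<sigma> \<tau> \<rho>] dev_sum[OF assms(1) this]
  from sum(2) have "real_of_int (dev \<sigma> i + dev \<tau> j + dev \<rho> (- i - j)) / real q \<in> {1, 2}"
    using q_ge_2 by (auto simp del: of_int_add)
  then show "\<bar>pos \<kappa> \<sigma> i + pos \<kappa> \<tau> j + pos \<kappa> \<rho> (- i - j)\<bar> = 1 / 2"
    unfolding sum(1) by auto
qed

lemma pos_shift:
  "pos \<kappa> (\<lambda>t. \<sigma> (t + s)) i = pos \<kappa> \<sigma> (i + int q * s) - (\<kappa> * real q + real p) * real_of_int s"
  unfolding pos_def dev_shift using q_ge_2 by (simp add: field_simps)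

text \<open>Shifting the binary sequences shifts the lattice indices by multiples of
  \<open>q\<close>; the offsets are proportional to \<open>s\<close>, \<open>t\<close>,
  \<open>r\<close> and cancel.\<close>

lemma translated_lattice_of:
  assumes ne: "never_equal \<sigma> \<tau> \<rho>" and "1 \<le> \<kappa>" and "s + t + r = 0"
  shows "translated (lattice_of \<kappa> \<sigma> \<tau> \<rho>)
    (lattice_of \<kappa> (\<lambda>n. \<sigma> (n + s)) (\<lambda>n. \<tau> (n + t)) (\<lambda>n. \<rho> (n + r)))"
proof -
  let ?x = "\<lambda>s. - ((\<kappa> * real q + real p) * real_of_int s)"
  have "?x s + ?x t + ?x r = - ((\<kappa> * real q + real p) * real_of_int (s + t + r))"
    by (simp add: algebra_simps)
  then have "?x s + ?x t + ?x r = 0" unfolding assms(3) by simp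
  moreover have "lattice_of \<kappa> (\<lambda>n. \<sigma> (n + s)) (\<lambda>n. \<tau> (n + t)) (\<lambda>n. \<rho> (n + r)) =
    (\<lambda>n. pos \<kappa> \<sigma> (n + int q * s) + ?x s, \<lambda>n. pos \<kappa> \<tau> (n + int q * t) + ?x t,
     \<lambda>n. pos \<kappa> \<rho> (n + int q * r) + ?x r)"
    by (simp add: lattice_of_def fun_eq_iff pos_shift)
  ultimately show ?thesis
    using sturmian_lattice_of[OF never_equal_shift[OF ne assms(3)] assms(2)]
    unfolding lattice_of_def[of \<kappa> \<sigma>] translated.simps by blast
qed

text \<open>The summand \<open>int q\<close> in \<open>dev_minus\<close> contributes -1, which
  brings the reversed offset 1/2 back to -1/2.\<close>

lemma reversed_lattice_of:
  "reversed (lattice_of \<kappa> \<sigma> \<tau> \<rho>) =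
    lattice_of \<kappa> (\<lambda>s. \<not> \<sigma> (- s)) (\<lambda>s. \<not> \<tau> (- s)) (\<lambda>s. \<not> \<rho> (- s))"
proof -
  have "- pos \<kappa> \<sigma> (- i) = pos \<kappa> (\<lambda>s. \<not> \<sigma> (- s)) i" for \<sigma> i
    unfolding pos_def dev_minus[of \<sigma> i] using q_ge_2 by (simp add: field_simps)
  then show ?thesis by (simp add: lattice_of_def)
qed

end

section \<open>Isometries\<close>

lemma sturmian_swap12: "sturmian_lattice (a, b, c) \<Longrightarrow> sturmian_lattice (b, a, c)"
  unfolding sturmian_lattice_iff by (metis add.commute diff_conv_add_uminus)

lemma sturmian_swap23: "sturmian_lattice (a, b, c) \<Longrightarrow> sturmian_lattice (a, c, b)"
proof -
  assume L: "sturmian_lattice (a, b, c)"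
  have "\<bar>a i + c j + b (- i - j)\<bar> = 1 / 2" for i j
  proof -
    have "- i - (- i - j) = j" by simp
    then have "\<bar>a i + b (- i - j) + c j\<bar> = 1 / 2"
      using L unfolding sturmian_lattice_iff by metis
    then show ?thesis by (simp add: ac_simps)
  qed
  then show ?thesis using L unfolding sturmian_lattice_iff by blast
qed

lemma separated_reversed: "separated f \<Longrightarrow> separated (\<lambda>n. - f (- n))"
  unfolding separated_def
proof
  fix i
  assume "\<forall>i. 1 \<le> f (i + 1) - f i"
  from spec[OF this, of "- i - 1"] show "1 \<le> - f (- (i + 1)) - - f (- i)" by simp
qed

lemma sturmian_reversed: "sturmian_lattice L \<Longrightarrow> sturmian_lattice (reversed L)"
proof (cases L)
  case (fields a b c)
  assume "sturmian_lattice L"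
  then have L: "separated a" "separated b" "separated c"
    "\<And>i j. \<bar>a i + b j + c (- i - j)\<bar> = 1 / 2"
    unfolding fields sturmian_lattice_iff by auto
  have "\<bar>- a (- i) + - b (- j) + - c (- (- i - j))\<bar> = 1 / 2" for i j
  proof -
    have eq: "- (- i) - (- j) = - (- i - j)" by simp
    show ?thesis using L(4)[of "- i" "- j"] unfolding eq by linarith
  qed
  then show ?thesis
    unfolding fields reversed.simps sturmian_lattice_iff using L separated_reversed by blast
qed

lemma translated_sturmian: "translated L L' \<Longrightarrow> sturmian_lattice L'"
  by (cases L) auto

lemma translated_trans:
  assumes "translated L L'" "translated L' L''"
  shows "translated L L''"
proof (cases L)
  case (fields a b c)
  obtain i j k x y z where sum: "x + y + z = 0"
    and L': "L' = (\<lambda>n. a (n + i) + x, \<lambda>n. b (n + j) + y, \<lambda>n. c (n + k) + z)"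
    using assms(1) unfolding fields by auto
  obtain i' j' k' x' y' z' where sum': "x' + y' + z' = 0"
    and L'': "L'' = (\<lambda>n. a (n + i' + i) + x + x', \<lambda>n. b (n + j' + j) + y + y',
      \<lambda>n. c (n + k' + k) + z + z')"
    using assms(2) unfolding L' by auto
  have "L'' = (\<lambda>n. a (n + (i' + i)) + (x + x'), \<lambda>n. b (n + (j' + j)) + (y + y'),
      \<lambda>n. c (n + (k' + k)) + (z + z'))" "(x + x') + (y + y') + (z + z') = 0"
    using L'' sum sum' by (simp_all add: add.assoc)
  then show ?thesis
    unfolding fields translated.simps using translated_sturmian[OF assms(2)] by blast
qed

lemma translated_swap12:
  assumes "translated (a, b, c) (a', b', c')"
  shows "translated (b, a, c) (b', a', c')"
  using assms sturmian_swap12[of a' b' c'] unfolding translated.simps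
  by clarify (metis (no_types, lifting) add.commute)

lemma translated_swap23:
  assumes "translated (a, b, c) (a', b', c')"
  shows "translated (a, c, b) (a', c', b')"
  using assms sturmian_swap23[of a' b' c'] unfolding translated.simps
  by clarify (metis (no_types, lifting) add.commute add.assoc)

lemma translated_reversed:
  assumes "translated L L'"
  shows "translated (reversed L) (reversed L')"
proof (cases L)
  case (fields a b c)
  obtain i j k x y z where sum: "x + y + z = 0"
    and L': "L' = (\<lambda>n. a (n + i) + x, \<lambda>n. b (n + j) + y, \<lambda>n. c (n + k) + z)"
    using assms unfolding fields by auto
  have "reversed L' = (\<lambda>n. - a (- (n + - i)) + - x, \<lambda>n. - b (- (n + - j)) + - y,
      \<lambda>n. - c (- (n + - k)) + - z)" "- x + - y + - z = 0"
    using L' sum by simp_all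
  then show ?thesis
    unfolding fields translated.simps reversed.simps
    using sturmian_reversed[OF translated_sturmian[OF assms]] by blast
qed

lemma reversed_reversed: "reversed (reversed L) = L"
  by (cases L) simp

lemma isometric_translated:
  "isometric L L' \<Longrightarrow> translated L' L'' \<Longrightarrow> isometric L L''"
  unfolding isometric_def using translated_trans by blast

lemma isometric_reversed: "isometric L L' \<Longrightarrow> isometric L (reversed L')"
  unfolding isometric_def using translated_reversed reversed_reversed by metis

lemma translated_isometric: "translated L L' \<Longrightarrow> isometric L L'"
  unfolding isometric_def by (cases L) auto

text \<open>The swap passes through translation and reversal to the permuted copy of
  \<open>L\<close>, and \<open>direction_perms\<close> is closed under it. Together with the swap of
  the last two directions it generates all permutations.\<close>

lemma isometric_swap12: "isometric L (a, b, c) \<Longrightarrow> isometric L (b, a, c)"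
proof -
  assume "isometric L (a, b, c)"
  then obtain a0 b0 c0 where M: "(a0, b0, c0) \<in> direction_perms L"
    and "translated (a0, b0, c0) (a, b, c) \<or> translated (reversed (a0, b0, c0)) (a, b, c)"
    unfolding isometric_def by (metis prod_cases3)
  then have "translated (b0, a0, c0) (b, a, c) \<or> translated (reversed (b0, a0, c0)) (b, a, c)"
    unfolding reversed.simps using translated_swap12 by blast
  moreover have "(b0, a0, c0) \<in> direction_perms L" using M by (cases L) auto
  ultimately show ?thesis unfolding isometric_def by blast
qed

lemma isometric_swap23: "isometric L (a, b, c) \<Longrightarrow> isometric L (a, c, b)"
proof -
  assume "isometric L (a, b, c)"
  then obtain a0 b0 c0 where M: "(a0, b0, c0) \<in> direction_perms L"
    and "translated (a0, b0, c0) (a, b, c) \<or> translated (reversed (a0, b0, c0)) (a, b, c)"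
    unfolding isometric_def by (metis prod_cases3)
  then have "translated (a0, c0, b0) (a, c, b) \<or> translated (reversed (a0, c0, b0)) (a, c, b)"
    unfolding reversed.simps using translated_swap23 by blast
  moreover have "(a0, c0, b0) \<in> direction_perms L" using M by (cases L) auto
  ultimately show ?thesis unfolding isometric_def by blast
qed

section \<open>Periodicity of one of the words as an isometry invariant\<close>

text \<open>With \<open>m = q\<close> this holds in the free case and fails in the rigid one. Asking
  it of some word, not of a particular one, makes it insensitive to permutations of the
  directions.\<close>

definition some_period :: "int \<Rightarrow> lattice \<Rightarrow> bool" where
  "some_period m L \<longleftrightarrow>
     (case words L of (f, g, h) \<Rightarrow>
       (\<forall>n. f (n + m) = f n) \<or> (\<forall>n. g (n + m) = g n) \<or> (\<forall>n. h (n + m) = h n))"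

lemma range_shift_int: "range (\<lambda>n. f (n + i)) = range f" for i :: int
proof -
  have "f n \<in> range (\<lambda>n. f (n + i))" for n
    by (rule range_eqI[of _ _ "n - i"]) simp
  then show ?thesis by auto
qed

lemma range_reflect_int: "range (\<lambda>n. f (- n - 1)) = range f" for f :: "int \<Rightarrow> 'a"
proof -
  have "f n \<in> range (\<lambda>n. f (- n - 1))" for n
    by (rule range_eqI[of _ _ "- n - 1"]) simp
  then show ?thesis by auto
qed

lemma widths_translated:
  assumes "translated L L'"
  shows "widths L' = widths L"
proof (cases L)
  case (fields a b c)
  obtain i j k x y z where
    L': "L' = (\<lambda>n. a (n + i) + x, \<lambda>n. b (n + j) + y, \<lambda>n. c (n + k) + z)"
    using assms unfolding fields by auto
  show ?thesis
    unfolding L' fields widths.simps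
    using range_shift_int[of "\<lambda>n. a (n + 1) - a n" i] range_shift_int[of "\<lambda>n. b (n + 1) - b n" j]
      range_shift_int[of "\<lambda>n. c (n + 1) - c n" k]
    by (simp add: ac_simps)
qed

lemma widths_reversed: "widths (reversed L) = widths L"
proof (cases L)
  case (fields a b c)
  show ?thesis
    unfolding fields widths.simps reversed.simps
    using range_reflect_int[of "\<lambda>n. a (n + 1) - a n"] range_reflect_int[of "\<lambda>n. b (n + 1) - b n"]
      range_reflect_int[of "\<lambda>n. c (n + 1) - c n"]
    by simp
qed

lemma period_shift_iff: "(\<forall>n. f (n + m + i) = f (n + i)) \<longleftrightarrow> (\<forall>n. f (n + m) = f n)" for m i :: int
proof (intro iffI allI)
  fix n
  assume "\<forall>n. f (n + m + i) = f (n + i)"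
  from spec[OF this, of "n - i"] show "f (n + m) = f n" by (simp add: algebra_simps)
next
  fix n
  assume "\<forall>n. f (n + m) = f n"
  from spec[OF this, of "n + i"] show "f (n + m + i) = f (n + i)" by (simp add: ac_simps)
qed

lemma period_reflect_iff: "(\<forall>n. f (- (n + m) - 1) = f (- n - 1)) \<longleftrightarrow> (\<forall>n. f (n + m) = f n)"
  for m :: int
proof (intro iffI allI)
  fix n
  assume "\<forall>n. f (- (n + m) - 1) = f (- n - 1)"
  from spec[OF this, of "- n - m - 1"] show "f (n + m) = f n" by simp
next
  fix n
  assume "\<forall>n. f (n + m) = f n"
  from spec[OF this, of "- (n + m) - 1"] show "f (- (n + m) - 1) = f (- n - 1)" by simp
qed

lemma some_period_translated:
  assumes "translated L L'"
  shows "some_period m L' \<longleftrightarrow> some_period m L"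
proof (cases L)
  case (fields a b c)
  obtain i j k x y z where
    L': "L' = (\<lambda>n. a (n + i) + x, \<lambda>n. b (n + j) + y, \<lambda>n. c (n + k) + z)"
    using assms unfolding fields by auto
  have min: "min_width L' = min_width L"
    unfolding min_width_def widths_translated[OF assms] ..
  have shift: "color_word \<kappa> (\<lambda>n. f (n + i) + x) = (\<lambda>n. color_word \<kappa> f (n + i))" for \<kappa> f i x
    by (simp add: color_word_def fun_eq_iff ac_simps)
  show ?thesis
    using min unfolding some_period_def L' fields words.simps Let_def shift
    by (simp add: period_shift_iff)
qed

lemma some_period_reversed: "some_period m (reversed L) \<longleftrightarrow> some_period m L"
proof (cases L)
  case (fields a b c)
  have min: "min_width (reversed L) = min_width L"
    unfolding min_width_def widths_reversed ..
  \<comment> \<open>The gap from \<open>n\<close> to \<open>n + 1\<close> is reflected to the gap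
    from \<open>- n - 1\<close> to \<open>- n\<close>, hence the index
    \<open>- n - 1\<close>.\<close>
  have refl: "color_word \<kappa> (\<lambda>n. - f (- n)) = (\<lambda>n. color_word \<kappa> f (- n - 1))" for \<kappa> f
    by (simp add: color_word_def fun_eq_iff ac_simps)
  show ?thesis
    using min unfolding some_period_def fields reversed.simps words.simps Let_def refl
    by (simp only: split_conv period_reflect_iff)
qed

lemma some_period_perm:
  assumes "M \<in> direction_perms L"
  shows "some_period m M \<longleftrightarrow> some_period m L"
proof (cases L)
  case (fields a b c)
  have "widths M = widths L" using assms unfolding fields by auto
  then have "min_width M = min_width L" by (simp add: min_width_def)
  then show ?thesis using assms unfolding fields some_period_def by (auto simp: Let_def)
qed

lemma some_period_isometric:
  assumes "isometric L L'"
  shows "some_period m L' \<longleftrightarrow> some_period m L"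
  using assms unfolding isometric_def
  by (metis some_period_translated some_period_reversed some_period_perm)

section \<open>Normal form of a two-color lattice\<close>

text \<open>Compare the triples \<open>(i, t)\<close> and \<open>(j, t + (i - j))\<close>, which
  share the third index. If \<open>X\<close> dropped by more than \<open>d\<close> from
  \<open>i\<close> to \<open>j\<close>, then \<open>Y\<close> would have to grow over every shift by
  \<open>i - j\<close>, contrary to the absence of drift.\<close>

lemma oscillation_le:
  fixes X Y Z :: "int \<Rightarrow> int"
  assumes sum: "\<And>i j k. i + j + k = 0 \<Longrightarrow> X i + Y j + Z k \<in> {e, e + d}" and d: "0 \<le> d"
    and drift: "(\<lambda>n. real_of_int (Y (int n) - Y (- int n)) / real (2 * n)) \<longlonglongrightarrow> 0"
  shows "X i - X j \<le> d"
proof (rule ccontr)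
  assume large: "\<not> ?thesis"
  have mono: "Y t < Y (t + (i - j))" for t
    using sum[of i t "- i - t"] sum[of j "t + (i - j)" "- i - t"] large d by auto
  consider "i = j" | "0 < i - j" | "0 < j - i" by linarith
  then show False
  proof cases
    case 1
    then show ?thesis using large d by simp
  next
    case 2
    then show ?thesis using no_upward_drift[OF drift] mono by blast
  next
    case 3
    have "Y (t + (j - i)) < Y t" for t using mono[of "t + (j - i)"] by simp
    then show ?thesis using no_downward_drift[OF drift 3] by blast
  qed
qed

lemma bounded_int_attains_min:
  fixes X :: "'a \<Rightarrow> int"
  assumes "\<And>i. l \<le> X i"
  obtains i0 where "\<And>i. X i0 \<le> X i"
proof -
  obtain i0 where i0: "\<forall>i. nat (X i0 - l) \<le> nat (X i - l)"
    using ex_has_least_nat[of "\<lambda>_. True" undefined "\<lambda>i. nat (X i - l)"] by auto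
  have "X i0 \<le> X i" for i
    using spec[OF i0, of i] assms[of i] by (simp add: nat_le_eq_zle)
  then show ?thesis by (rule that)
qed

lemma oscillation_attained:
  fixes X :: "'a \<Rightarrow> int"
  assumes "\<And>i j. X i - X j \<le> d"
  obtains i0 i1 where "\<And>i. X i0 \<le> X i" "\<And>i. X i \<le> X i1" "X i1 - d \<le> X i0"
proof -
  \<comment> \<open>Any fixed index serves as reference; \<open>undefined\<close> supplies
    one.\<close>
  have low: "X undefined - d \<le> X i" for i using assms[of undefined i] by linarith
  have high: "- X undefined - d \<le> - X i" for i using assms[of i undefined] by linarith
  obtain i0 where i0: "\<And>i. X i0 \<le> X i" using bounded_int_attains_min[of _ X, OF low] by blast
  obtain i1 where i1: "\<And>i. - X i1 \<le> - X i"
    using bounded_int_attains_min[of _ "\<lambda>i. - X i", OF high] by blast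
  show ?thesis
  proof (rule that[of i0 i1])
    show "X i0 \<le> X i" for i by (rule i0)
    show "X i \<le> X i1" for i using i1[of i] by simp
    show "X i1 - d \<le> X i0" using assms[of i1 i0] by simp
  qed
qed

lemma intermediate_sum3:
  fixes l1 l2 l3 u1 u2 u3 s :: int
  assumes "l1 \<le> u1" "l2 \<le> u2" "l3 \<le> u3" "l1 + l2 + l3 \<le> s" "s \<le> u1 + u2 + u3"
  obtains x1 x2 x3 where "l1 \<le> x1" "x1 \<le> u1" "l2 \<le> x2" "x2 \<le> u2" "l3 \<le> x3" "x3 \<le> u3"
    "x1 + x2 + x3 = s"
proof -
  \<comment> \<open>Greedy choice: each number is as large as possible while the later ones keep
    their lower bounds.\<close>
  define x1 where "x1 = min u1 (s - l2 - l3)"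
  define x2 where "x2 = min u2 (s - x1 - l3)"
  show ?thesis
    by (rule that[of x1 x2 "s - x1 - x2"]) (use assms in \<open>auto simp: x1_def x2_def\<close>)
qed

lemma integer_part:
  assumes step: "\<And>i. f (i + 1) - f i \<in> {\<kappa>, \<kappa> + 1}"
  obtains P :: "int \<Rightarrow> int" where "\<And>i. f i = f 0 + \<kappa> * real_of_int i + real_of_int (P i)"
proof -
  have int: "f i - f 0 - \<kappa> * real_of_int i \<in> \<int>" for i
  proof (induction i rule: int_induct[where k = 0])
    case (step1 i)
    have "f (i + 1) - f 0 - \<kappa> * real_of_int (i + 1) =
        (f i - f 0 - \<kappa> * real_of_int i) + (f (i + 1) - f i - \<kappa>)"
      by (simp add: algebra_simps)
    moreover have "f (i + 1) - f i - \<kappa> \<in> \<int>" using step[of i] by auto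
    ultimately show ?case using step1 by (metis Ints_add)
  next
    case (step2 i)
    have "f (i - 1) - f 0 - \<kappa> * real_of_int (i - 1) =
        (f i - f 0 - \<kappa> * real_of_int i) - (f (i - 1 + 1) - f (i - 1) - \<kappa>)"
      by (simp add: algebra_simps)
    moreover have "f (i - 1 + 1) - f (i - 1) - \<kappa> \<in> \<int>" using step[of "i - 1"] by auto
    ultimately show ?case using step2 by (metis Ints_diff)
  qed simp
  have fl: "f i - f 0 - \<kappa> * real_of_int i = real_of_int \<lfloor>f i - f 0 - \<kappa> * real_of_int i\<rfloor>" for i
    using int[of i] by (elim Ints_cases) simp
  show ?thesis
  proof (rule that)
    fix i
    show "f i = f 0 + \<kappa> * real_of_int i + real_of_int \<lfloor>f i - f 0 - \<kappa> * real_of_int i\<rfloor>"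
      using fl[of i] by linarith
  qed
qed

context rational_slope
begin

section \<open>From a lattice to binary sequences\<close>

lemma deviation:
  assumes step: "\<And>i. f (i + 1) - f i \<in> {\<kappa>, \<kappa> + 1}"
    and density: "has_density (color_word \<kappa> f) (real p / real q)"
  obtains X :: "int \<Rightarrow> int" where
    "\<And>i. f i = f 0 + \<kappa> * real_of_int i + real_of_int (X i + int p * i) / real q"
    "\<And>i. int q dvd X i + int p * i"
    "(\<lambda>n. real_of_int (X (int n) - X (- int n)) / real (2 * n)) \<longlonglongrightarrow> 0"
proof -
  obtain P :: "int \<Rightarrow> int" where P: "\<And>i. f i = f 0 + \<kappa> * real_of_int i + real_of_int (P i)"
    using integer_part[of f \<kappa>, OF step] by blast
  have "real_of_int (color_word \<kappa> f i) = real_of_int (P (i + 1) - P i)" for i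
    using step[of i] P[of i] P[of "i + 1"] by (auto simp: color_word_def algebra_simps)
  then have word: "color_word \<kappa> f i = P (i + 1) - P i" for i by (simp only: of_int_eq_iff)
  \<comment> \<open>Scaling by \<open>q\<close> keeps the difference from the line of slope
    \<open>p / q\<close> integral.\<close>
  define X where "X i = int q * P i - int p * i" for i
  have "int q * color_word \<kappa> f i = X (i + 1) - X i + int p" for i
    by (simp add: word X_def algebra_simps)
  then have "(\<lambda>n. real_of_int (X (int n) - X (- int n)) / real (2 * n)) \<longlonglongrightarrow> 0"
    using has_density_iff[of q "color_word \<kappa> f" X p] density q_ge_2 by simp
  moreover have "f i = f 0 + \<kappa> * real_of_int i + real_of_int (X i + int p * i) / real q" for i
    using P[of i] q_ge_2 by (simp add: X_def)
  moreover have "int q dvd X i + int p * i" for i by (simp add: X_def)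
  ultimately show ?thesis using that by blast
qed

lemma residue_solution:
  obtains r where "int q dvd m + int p * r"
proof -
  obtain x where x: "[int p * x = 1] (mod int q)"
    using cong_solve_coprime_int[of "int p" "int q"] coprime by auto
  have "int q dvd int p * x - 1" using x by (simp add: cong_iff_dvd_diff)
  then have "int q dvd (int p * x - 1) * (- m)" by (rule dvd_mult2)
  then have "int q dvd m + int p * (- m * x)" by (simp add: algebra_simps)
  then show ?thesis by (rule that)
qed

text \<open>Moving the value \<open>m\<close> to 0 and the index \<open>r\<close> to the origin
  restores the range and the congruence that characterize \<open>dev\<close>.\<close>

lemma dev_of_bounds:
  assumes "\<And>i. m \<le> X i" "\<And>i. X i \<le> m + int q" "\<And>i. int q dvd X i + int p * i"
    and "int q dvd m + int p * r"
  obtains \<sigma> where "\<And>n. X (n + r) = dev \<sigma> n + m"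
proof -
  have "int q dvd (X (n + r) - m) + int p * n" for n
    using dvd_diff[OF assms(3)[of "n + r"] assms(4)] by (simp add: algebra_simps)
  moreover have "0 \<le> X (n + r) - m" "X (n + r) - m \<le> int q" for n
    using assms(1,2)[of "n + r"] by linarith+
  ultimately obtain \<sigma> where "(\<lambda>n. X (n + r) - m) = dev \<sigma>"
    using dev_unique[of "\<lambda>n. X (n + r) - m"] by blast
  then have "X (n + r) = dev \<sigma> n + m" for n by (simp add: fun_eq_iff algebra_simps)
  then show ?thesis by (rule that)
qed

text \<open>Each of \<open>X\<close>, \<open>Y\<close>, \<open>Z\<close> fits into an interval of length \<open>q\<close>. If it occupies only \<open>q\<close>
  consecutive values, there are two such intervals, and the choice is made so that the lower end
  points add up to \<open>e - q\<close>. The index at which the lower end point is congruent to the values of the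
  sequence then marks the origin.\<close>

lemma common_normalization:
  fixes X Y Z :: "int \<Rightarrow> int"
  assumes sum: "\<And>i j k. i + j + k = 0 \<Longrightarrow> X i + Y j + Z k \<in> {e, e + int q}"
    and e: "int q dvd e"
    and dvd: "\<And>i. int q dvd X i + int p * i" "\<And>i. int q dvd Y i + int p * i"
      "\<And>i. int q dvd Z i + int p * i"
    and osc: "\<And>i j. X i - X j \<le> int q" "\<And>i j. Y i - Y j \<le> int q" "\<And>i j. Z i - Z j \<le> int q"
  obtains \<sigma> \<tau> \<rho> r s t x y z where "never_equal \<sigma> \<tau> \<rho>" "r + s + t = 0" "x + y + z = e - int q"
    "\<And>n. X (n + r) = dev \<sigma> n + x" "\<And>n. Y (n + s) = dev \<tau> n + y" "\<And>n. Z (n + t) = dev \<rho> n + z"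
proof -
  obtain i0 i1 where X: "\<And>i. X i0 \<le> X i" "\<And>i. X i \<le> X i1" "X i1 - int q \<le> X i0"
    using oscillation_attained[of X, OF osc(1)] by blast
  obtain j0 j1 where Y: "\<And>i. Y j0 \<le> Y i" "\<And>i. Y i \<le> Y j1" "Y j1 - int q \<le> Y j0"
    using oscillation_attained[of Y, OF osc(2)] by blast
  obtain k0 k1 where Z: "\<And>i. Z k0 \<le> Z i" "\<And>i. Z i \<le> Z k1" "Z k1 - int q \<le> Z k0"
    using oscillation_attained[of Z, OF osc(3)] by blast
  \<comment> \<open>A triple through two minima has sum at least \<open>e\<close>, and its third
    value exceeds the third minimum by at most \<open>q\<close>. Dually the maxima add up to at most
    \<open>e + 2 * q\<close>, so a triple of lower ends with sum \<open>e - q\<close>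
    exists.\<close>
  have "e - int q \<le> X i0 + Y j0 + Z k0"
    using sum[of i0 j0 "- i0 - j0"] osc(3)[of "- i0 - j0" k0] by auto
  moreover have "(X i1 - int q) + (Y j1 - int q) + (Z k1 - int q) \<le> e - int q"
    using sum[of i1 j1 "- i1 - j1"] osc(3)[of k1 "- i1 - j1"] by auto
  ultimately obtain x y z where x: "X i1 - int q \<le> x" "x \<le> X i0"
    and y: "Y j1 - int q \<le> y" "y \<le> Y j0" and z: "Z k1 - int q \<le> z" "z \<le> Z k0"
    and xyz: "x + y + z = e - int q"
    using intermediate_sum3[OF X(3) Y(3) Z(3)] by blast
  obtain r where r: "int q dvd x + int p * r" by (rule residue_solution)
  obtain s where s: "int q dvd y + int p * s" by (rule residue_solution)
  \<comment> \<open>The third shift is forced by the index plane; its congruence follows since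
    \<open>x + y + z\<close> is divisible by \<open>q\<close>.\<close>
  define t where "t = - r - s"
  have "z + int p * t = e - int q - (x + int p * r) - (y + int p * s)"
    using xyz by (simp add: t_def algebra_simps)
  then have t: "int q dvd z + int p * t"
    using e r s by (metis dvd_diff dvd_refl)
  have bounds: "x \<le> X i" "X i \<le> x + int q" "y \<le> Y i" "Y i \<le> y + int q" "z \<le> Z i" "Z i \<le> z + int q"
    for i
    using X(1,2)[of i] Y(1,2)[of i] Z(1,2)[of i] x y z by linarith+
  obtain \<sigma> where \<sigma>: "\<And>n. X (n + r) = dev \<sigma> n + x"
    using dev_of_bounds[of x X, OF bounds(1,2) dvd(1) r] by blast
  obtain \<tau> where \<tau>: "\<And>n. Y (n + s) = dev \<tau> n + y"
    using dev_of_bounds[of y Y, OF bounds(3,4) dvd(2) s] by blast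
  obtain \<rho> where \<rho>: "\<And>n. Z (n + t) = dev \<rho> n + z"
    using dev_of_bounds[of z Z, OF bounds(5,6) dvd(3) t] by blast
  have "never_equal \<sigma> \<tau> \<rho>"
  proof (rule never_equal_if_dev_sum)
    fix i j
    have "X (i + r) + Y (j + s) + Z (- i - j + t) \<in> {e, e + int q}"
      by (rule sum) (simp add: t_def)
    then show "dev \<sigma> i + dev \<tau> j + dev \<rho> (- i - j) \<in> {int q, 2 * int q}"
      unfolding \<sigma> \<tau> \<rho> using xyz by auto
  qed
  then show ?thesis using that[OF _ _ xyz \<sigma> \<tau> \<rho>] by (simp add: t_def)
qed

lemma normal_form:
  assumes L: "sturmian_lattice (a, b, c)"
    and steps: "\<And>i. a (i + 1) - a i \<in> {\<kappa>, \<kappa> + 1}" "\<And>i. b (i + 1) - b i \<in> {\<kappa>, \<kappa> + 1}"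
      "\<And>i. c (i + 1) - c i \<in> {\<kappa>, \<kappa> + 1}"
    and density: "has_density (color_word \<kappa> a) (real p / real q)"
      "has_density (color_word \<kappa> b) (real p / real q)"
      "has_density (color_word \<kappa> c) (real p / real q)"
    and \<kappa>: "1 \<le> \<kappa>"
  obtains \<sigma> \<tau> \<rho> where "never_equal \<sigma> \<tau> \<rho>" "translated (a, b, c) (lattice_of \<kappa> \<sigma> \<tau> \<rho>)"
proof -
  obtain X where X: "\<And>i. a i = a 0 + \<kappa> * real_of_int i + real_of_int (X i + int p * i) / real q"
    "\<And>i. int q dvd X i + int p * i"
    "(\<lambda>n. real_of_int (X (int n) - X (- int n)) / real (2 * n)) \<longlonglongrightarrow> 0"
    using deviation[of a, OF steps(1) density(1)] by blast
  obtain Y where Y: "\<And>i. b i = b 0 + \<kappa> * real_of_int i + real_of_int (Y i + int p * i) / real q"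
    "\<And>i. int q dvd Y i + int p * i"
    "(\<lambda>n. real_of_int (Y (int n) - Y (- int n)) / real (2 * n)) \<longlonglongrightarrow> 0"
    using deviation[of b, OF steps(2) density(2)] by blast
  obtain Z where Z: "\<And>i. c i = c 0 + \<kappa> * real_of_int i + real_of_int (Z i + int p * i) / real q"
    "\<And>i. int q dvd Z i + int p * i"
    "(\<lambda>n. real_of_int (Z (int n) - Z (- int n)) / real (2 * n)) \<longlonglongrightarrow> 0"
    using deviation[of c, OF steps(3) density(3)] by blast
  have half: "\<bar>a i + b j + c (- i - j)\<bar> = 1 / 2" for i j
    using L unfolding sturmian_lattice_iff by blast
  obtain m :: int where m: "m = 0 \<or> m = 1" "a 0 + b 0 + c 0 = real_of_int m - 1 / 2"
  proof -
    have "a 0 + b 0 + c 0 = real_of_int 0 - 1 / 2 \<or> a 0 + b 0 + c 0 = real_of_int 1 - 1 / 2"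
      using half[of 0 0] by (simp add: abs_if split: if_splits)
    then show ?thesis using that by blast
  qed
  \<comment> \<open>\<open>X\<close>, \<open>Y\<close>, \<open>Z\<close> measure positions relative
    to index 0, so their sums divided by \<open>q\<close> are the triple sums minus
    \<open>a 0 + b 0 + c 0\<close>, that is \<open>- m\<close> or \<open>1 - m\<close>.\<close>
  define e where "e = - (int q * m)"
  have sum: "X i + Y j + Z k \<in> {e, e + int q}" if ijk: "i + j + k = 0" for i j k
  proof -
    have k: "k = - i - j" and k': "real_of_int k = - real_of_int i - real_of_int j"
      using ijk by simp_all
    have "a i + b j + c k = a 0 + b 0 + c 0 + real_of_int (X i + Y j + Z k) / real q"
      unfolding X(1)[of i] Y(1)[of j] Z(1)[of k] of_int_add of_int_mult k'
      by (simp add: algebra_simps add_divide_distrib diff_divide_distrib)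
    then have "real_of_int (X i + Y j + Z k) / real q = a i + b j + c k - real_of_int m + 1 / 2"
      using m(2) by simp
    moreover have "a i + b j + c k = - 1 / 2 \<or> a i + b j + c k = 1 / 2"
      using half[of i j] k by (simp add: abs_if split: if_splits)
    ultimately have "real_of_int (X i + Y j + Z k) / real q = - real_of_int m \<or>
        real_of_int (X i + Y j + Z k) / real q = 1 - real_of_int m"
      by linarith
    then have "real_of_int (X i + Y j + Z k) = - real_of_int m * real q \<or>
        real_of_int (X i + Y j + Z k) = (1 - real_of_int m) * real q"
      using q_ge_2 by (simp add: divide_eq_eq del: of_int_add)
    moreover have "- real_of_int m * real q = real_of_int e"
      "(1 - real_of_int m) * real q = real_of_int (e + int q)"
      by (simp_all add: e_def left_diff_distrib)
    ultimately have "real_of_int (X i + Y j + Z k) = real_of_int e \<or>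
        real_of_int (X i + Y j + Z k) = real_of_int (e + int q)"
      by metis
    then show ?thesis unfolding of_int_eq_iff by blast
  qed
  have q: "0 \<le> int q" by simp
  \<comment> \<open>Absence of drift in one other sequence suffices: \<open>Y\<close> serves for
    \<open>X\<close>, and \<open>X\<close> for the other two.\<close>
  have osc1: "X i - X j \<le> int q" for i j
    by (rule oscillation_le[where X = X and Y = Y and Z = Z, OF _ q Y(3)]) (rule sum)
  have osc2: "Y i - Y j \<le> int q" for i j
  proof (rule oscillation_le[where X = Y and Y = X and Z = Z, OF _ q X(3)])
    fix i j k :: int
    assume "i + j + k = 0"
    then show "Y i + X j + Z k \<in> {e, e + int q}" using sum[of j i k] by (simp add: add.commute)
  qed
  have osc3: "Z i - Z j \<le> int q" for i j
  proof (rule oscillation_le[where X = Z and Y = X and Z = Y, OF _ q X(3)])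
    fix i j k :: int
    assume "i + j + k = 0"
    then have "j + k + i = 0" by simp
    from sum[OF this] show "Z i + X j + Y k \<in> {e, e + int q}" by (simp add: add.commute add.left_commute)
  qed
  have "int q dvd e" by (simp add: e_def)
  note normal = common_normalization[of X Y Z, OF sum this X(2) Y(2) Z(2) osc1 osc2 osc3]
  obtain \<sigma> \<tau> \<rho> r s t x y z where ne: "never_equal \<sigma> \<tau> \<rho>" and rst: "r + s + t = 0"
    and xyz: "x + y + z = e - int q"
    and dev: "\<And>n. X (n + r) = dev \<sigma> n + x" "\<And>n. Y (n + s) = dev \<tau> n + y"
      "\<And>n. Z (n + t) = dev \<rho> n + z"
    by (rule normal, assumption, rule that)
  \<comment> \<open>Chosen to turn the shifted sequence into \<open>pos\<close>: it cancels the
    value at 0, the linear part at the shift and the lower end \<open>x\<close>, and supplies the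
    -1/2.\<close>
  define off where "off f r x = - f - \<kappa> * real_of_int r - real_of_int (x + int p * r) / real q - 1 / 2"
    for f :: real and r x
  have "a (n + r) + off (a 0) r x = pos \<kappa> \<sigma> n" "b (n + s) + off (b 0) s y = pos \<kappa> \<tau> n"
    "c (n + t) + off (c 0) t z = pos \<kappa> \<rho> n" for n
    unfolding X(1)[of "n + r"] Y(1)[of "n + s"] Z(1)[of "n + t"] dev off_def pos_def
    by (simp_all add: distrib_left add_divide_distrib)
  then have lat: "lattice_of \<kappa> \<sigma> \<tau> \<rho> = (\<lambda>n. a (n + r) + off (a 0) r x,
      \<lambda>n. b (n + s) + off (b 0) s y, \<lambda>n. c (n + t) + off (c 0) t z)"
    by (simp add: lattice_of_def fun_eq_iff)
  have t: "t = - r - s" using rst by simp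
  have z: "z = e - int q - x - y" using xyz by simp
  \<comment> \<open>The lower ends contribute \<open>(q - e) / q = m + 1\<close> and the constants
    -3/2, which leaves \<open>m - 1 / 2\<close>.\<close>
  have "off (a 0) r x + off (b 0) s y + off (c 0) t z = - (a 0 + b 0 + c 0) + real_of_int m - 1 / 2"
    unfolding off_def t z e_def using q_ge_2
    by (simp add: right_diff_distrib add_divide_distrib diff_divide_distrib)
  then have off: "off (a 0) r x + off (b 0) s y + off (c 0) t z = 0" using m(2) by simp
  have "translated (a, b, c) (lattice_of \<kappa> \<sigma> \<tau> \<rho>)"
    unfolding translated.simps
    by (rule exI[of _ r], rule exI[of _ s], rule exI[of _ t], rule exI[of _ "off (a 0) r x"],
        rule exI[of _ "off (b 0) s y"], rule exI[of _ "off (c 0) t z"])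
      (intro conjI off lat sturmian_lattice_of ne \<kappa>)
  then show ?thesis using ne by (intro that)
qed

end

section \<open>Classification\<close>

lemma biword_right:
  assumes len: "length l = m" "length y = m" "length r = m" and m: "0 < m"
  shows "biword l [] y r n =
    (if n div int m < 0 then l else if n div int m = 0 then y else r) ! nat (n mod int m)"
proof -
  consider "n < 0" | "0 \<le> n" "n < int m" | "int m \<le> n" by linarith
  then show ?thesis
  proof cases
    case 1
    then show ?thesis using len m by (simp add: biword_def pos_imp_zdiv_neg_iff)
  next
    case 2
    then show ?thesis using len m by (simp add: biword_def)
  next
    case 3
    then have "0 < n div int m" using m by (simp add: pos_imp_zdiv_pos_iff)
    then show ?thesis using len m 3 by (simp add: biword_def)
  qed
qed

lemma biword_left:
  assumes len: "length l = m" "length x = m" "length r = m" and m: "0 < m"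
  shows "biword l x [] r n =
    (if n div int m < - 1 then l else if n div int m = - 1 then x else r) ! nat (n mod int m)"
proof -
  define n' where "n' = n + int m"
  have n: "n div int m = n' div int m - 1" "n mod int m = n' mod int m"
    using m by (simp_all add: n'_def)
  have "biword l x [] r n = biword l [] x r n'"
    using len m by (auto simp: biword_def n'_def)
  also have "\<dots> = (if n' div int m < 0 then l else if n' div int m = 0 then x else r) ! nat (n' mod int m)"
    by (rule biword_right[OF len m])
  finally show ?thesis unfolding n by simp
qed

context rational_slope
begin

lemma word_nth:
  "word \<sigma> n = ([if \<sigma> (n div int q) then 0 else 1] @ central_word p q @
     [if \<sigma> (n div int q + 1) then 1 else 0]) ! nat (n mod int q)"
  using word_block[of "n mod int q" \<sigma> "n div int q"] q_ge_2 by simp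

lemma length_block: "length ([x] @ central_word p q @ [y]) = q"
  using length_central_word q_ge_2 by simp

lemma biword_constant:
  "biword ([1] @ central_word p q @ [0]) [] [] ([1] @ central_word p q @ [0]) = word (\<lambda>_. False)"
  "biword ([0] @ central_word p q @ [1]) [] [] ([0] @ central_word p q @ [1]) = word (\<lambda>_. True)"
  by (rule ext, simp only: biword_def word_nth length_block list.size of_nat_0 diff_zero add_0_right,
      simp)+

text \<open>A block \<open>0c0\<close> has \<open>\<sigma>\<close> true at its start and false at
  the start of the next block. In block 0 it marks a fall with threshold 1, in block -1 a fall with
  threshold 0.\<close>

lemma biword_down:
  fixes u defines "u \<equiv> central_word p q"
  shows "biword ([0] @ u @ [1]) [] ([0] @ u @ [0]) ([1] @ u @ [0]) = word (\<lambda>s. s < 1)"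
    and "biword ([0] @ u @ [1]) ([0] @ u @ [0]) [] ([1] @ u @ [0]) = word (\<lambda>s. s < 0)"
proof -
  have q: "0 < q" using q_ge_2 by simp
  show "biword ([0] @ u @ [1]) [] ([0] @ u @ [0]) ([1] @ u @ [0]) = word (\<lambda>s. s < 1)"
    unfolding u_def by (rule ext, subst biword_right[OF length_block length_block length_block q])
      (simp add: word_nth)
  show "biword ([0] @ u @ [1]) ([0] @ u @ [0]) [] ([1] @ u @ [0]) = word (\<lambda>s. s < 0)"
    unfolding u_def by (rule ext, subst biword_left[OF length_block length_block length_block q])
      (simp add: word_nth)
qed

text \<open>Dually, a block \<open>1c1\<close> marks a rise at the start of the following
  block.\<close>

lemma biword_up:
  fixes u defines "u \<equiv> central_word p q"
  shows "biword ([1] @ u @ [0]) [] ([1] @ u @ [1]) ([0] @ u @ [1]) = word (\<lambda>s. 1 \<le> s)"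
    and "biword ([1] @ u @ [0]) ([1] @ u @ [1]) [] ([0] @ u @ [1]) = word (\<lambda>s. 0 \<le> s)"
proof -
  have q: "0 < q" using q_ge_2 by simp
  show "biword ([1] @ u @ [0]) [] ([1] @ u @ [1]) ([0] @ u @ [1]) = word (\<lambda>s. 1 \<le> s)"
    unfolding u_def by (rule ext, subst biword_right[OF length_block length_block length_block q])
      (simp add: word_nth)
  show "biword ([1] @ u @ [0]) ([1] @ u @ [1]) [] ([0] @ u @ [1]) = word (\<lambda>s. 0 \<le> s)"
    unfolding u_def by (rule ext, subst biword_left[OF length_block length_block length_block q])
      (simp add: word_nth)
qed

lemma swap_choice_if: "swap_choice (\<lambda>s. if \<sigma> s then [1, 0] else [0, 1])"
  by (simp add: swap_choice_def)

lemma swap_choiceE: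
  assumes "swap_choice w"
  obtains \<sigma> where "w = (\<lambda>s. if \<sigma> s then [1, 0] else [0, 1])"
  using assms by (intro that[of "\<lambda>s. w s = [1, 0]"]) (auto simp: swap_choice_def fun_eq_iff)

lemma central_form_word: "central_form (central_word p q) (word \<sigma>)"
  unfolding central_form_def word_def using swap_choice_if by blast

lemma case_free_lattice_of:
  "case_free (central_word p q) (\<lambda>s. if \<sigma> s then [1, 0] else [0, 1])
     (lattice_of \<kappa> \<sigma> (\<lambda>_. False) (\<lambda>_. True))"
  unfolding case_free_def words_lattice_of biword_constant by (simp add: word_def)

lemma case_rigid_iff:
  "case_rigid (central_word p q) L \<longleftrightarrow>
     words L = (word (\<lambda>s. s < 1), word (\<lambda>s. s < 0), word (\<lambda>s. s < 0)) \<or>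
     words L = (word (\<lambda>s. 1 \<le> s), word (\<lambda>s. 0 \<le> s), word (\<lambda>s. 0 \<le> s))"
  unfolding case_rigid_def biword_down biword_up ..

lemma case_free_imp_some_period:
  "case_free (central_word p q) w L \<Longrightarrow> some_period (int q) L"
  unfolding case_free_def biword_constant some_period_def
  using word_periodic_iff[of "\<lambda>_. False"] by simp

text \<open>All three words come from steps, none of which is constant.\<close>

lemma case_rigid_imp_not_some_period:
  "case_rigid (central_word p q) L \<Longrightarrow> \<not> some_period (int q) L"
proof -
  have nc: "\<exists>t. \<sigma> t \<noteq> \<sigma> 0" if "\<sigma> k \<noteq> \<sigma> (k - 1)" for \<sigma> :: "int \<Rightarrow> bool" and k
    using that by metis
  have not_per: "\<not> (\<forall>n. word (\<lambda>s. s < k) (n + int q) = word (\<lambda>s. s < k) n)"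
    "\<not> (\<forall>n. word (\<lambda>s. k \<le> s) (n + int q) = word (\<lambda>s. k \<le> s) n)" for k
    unfolding word_periodic_iff
    using nc[of "\<lambda>s. s < k" k] nc[of "\<lambda>s. k \<le> s" k] by simp_all
  show "case_rigid (central_word p q) L \<Longrightarrow> \<not> some_period (int q) L"
    unfolding case_rigid_iff some_period_def
    by (elim disjE) (simp_all only: prod.case not_per simp_thms not_False_eq_True)
qed

section \<open>Reduction of every normal form to one of the two cases\<close>

lemma free_if_opposite_constants:
  assumes "isometric L (lattice_of \<kappa> \<sigma> (\<lambda>_. x) (\<lambda>_. \<not> x))"
  shows "\<exists>L'. isometric L L' \<and> (\<exists>w. swap_choice w \<and> case_free (central_word p q) w L')"
proof -
  have "isometric L (lattice_of \<kappa> \<sigma> (\<lambda>_. False) (\<lambda>_. True))"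
  proof (cases x)
    case True
    then show ?thesis using assms isometric_swap23 unfolding lattice_of_def by simp
  next
    case False
    then show ?thesis using assms by simp
  qed
  then show ?thesis using case_free_lattice_of swap_choice_if by blast
qed

lemma free_if_constant:
  assumes ne: "never_equal (\<lambda>_. x) \<tau> \<rho>" and iso: "isometric L (lattice_of \<kappa> (\<lambda>_. x) \<tau> \<rho>)"
  shows "\<exists>L'. isometric L L' \<and> (\<exists>w. swap_choice w \<and> case_free (central_word p q) w L')"
  using never_equal_const[OF ne]
proof
  assume "\<tau> = (\<lambda>_. \<not> x)"
  then have "isometric L (lattice_of \<kappa> \<rho> (\<lambda>_. x) (\<lambda>_. \<not> x))"
    using iso isometric_swap12 isometric_swap23 unfolding lattice_of_def by blast
  then show ?thesis by (rule free_if_opposite_constants)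
next
  assume "\<rho> = (\<lambda>_. \<not> x)"
  then have "isometric L (lattice_of \<kappa> \<tau> (\<lambda>_. x) (\<lambda>_. \<not> x))"
    using iso isometric_swap12 unfolding lattice_of_def by blast
  then show ?thesis by (rule free_if_opposite_constants)
qed

lemma rigid_up:
  assumes iso: "isometric L (lattice_of \<kappa> (\<lambda>s. x \<le> s) (\<lambda>s. y \<le> s) (\<lambda>s. z \<le> s))"
    and ne: "never_equal (\<lambda>s. x \<le> s) (\<lambda>s. y \<le> s) (\<lambda>s. z \<le> s)"
    and sum: "x + y + z = 1" and \<kappa>: "1 \<le> \<kappa>"
  shows "\<exists>L'. isometric L L' \<and> case_rigid (central_word p q) L'"
proof -
  \<comment> \<open>These shifts move the thresholds to 1, 0, 0; their sum is 0 exactly because the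
    thresholds add up to 1.\<close>
  have "(x - 1) + y + z = 0" using sum by simp
  from isometric_translated[OF iso translated_lattice_of[OF ne \<kappa> this]]
  have "isometric L (lattice_of \<kappa> (\<lambda>s. 1 \<le> s) (\<lambda>s. 0 \<le> s) (\<lambda>s. 0 \<le> s))"
    by (simp add: le_diff_eq)
  then show ?thesis using case_rigid_iff words_lattice_of by blast
qed

lemma rigid_down:
  assumes iso: "isometric L (lattice_of \<kappa> (\<lambda>s. s < x) (\<lambda>s. s < y) (\<lambda>s. s < z))"
    and ne: "never_equal (\<lambda>s. s < x) (\<lambda>s. s < y) (\<lambda>s. s < z)"
    and sum: "x + y + z = 1" and \<kappa>: "1 \<le> \<kappa>"
  shows "\<exists>L'. isometric L L' \<and> case_rigid (central_word p q) L'"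
proof -
  have "(x - 1) + y + z = 0" using sum by simp
  from isometric_translated[OF iso translated_lattice_of[OF ne \<kappa> this]]
  have "isometric L (lattice_of \<kappa> (\<lambda>s. s < 1) (\<lambda>s. s < 0) (\<lambda>s. s < 0))"
    by (simp add: less_diff_eq algebra_simps)
  then show ?thesis using case_rigid_iff words_lattice_of by blast
qed

lemma free_or_rigid:
  assumes iso: "isometric L (lattice_of \<kappa> \<sigma> \<tau> \<rho>)" and ne: "never_equal \<sigma> \<tau> \<rho>"
    and \<kappa>: "1 \<le> \<kappa>"
  shows "(\<exists>L'. isometric L L' \<and> (\<exists>w. swap_choice w \<and> case_free (central_word p q) w L')) \<or>
    (\<exists>L'. isometric L L' \<and> case_rigid (central_word p q) L')"
proof -
  have const: "\<exists>x. f = (\<lambda>_. x)" if "(\<forall>s. f s) \<or> (\<forall>s. \<not> f s)" for f :: "int \<Rightarrow> bool"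
    by (rule exI[of _ "f 0"], rule ext) (use that in blast)
  consider "(\<forall>s. \<sigma> s) \<or> (\<forall>s. \<not> \<sigma> s)" | "(\<forall>s. \<tau> s) \<or> (\<forall>s. \<not> \<tau> s)"
    | "(\<forall>s. \<rho> s) \<or> (\<forall>s. \<not> \<rho> s)"
    | s1 s0 t1 t0 r1 r0 where "\<sigma> s1" "\<not> \<sigma> s0" "\<tau> t1" "\<not> \<tau> t0" "\<rho> r1" "\<not> \<rho> r0"
    by blast
  then show ?thesis
  proof cases
    case 1
    from const[OF this] obtain x where x: "\<sigma> = (\<lambda>_. x)" ..
    from ne iso show ?thesis unfolding x by (intro disjI1 free_if_constant)
  next
    case 2
    from const[OF this] obtain x where x: "\<tau> = (\<lambda>_. x)" ..
    have "isometric L (lattice_of \<kappa> \<tau> \<sigma> \<rho>)"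
      unfolding lattice_of_def by (rule isometric_swap12[OF iso[unfolded lattice_of_def]])
    with never_equal_swap12[OF ne] show ?thesis
      unfolding x by (intro disjI1 free_if_constant)
  next
    case 3
    from const[OF this] obtain x where x: "\<rho> = (\<lambda>_. x)" ..
    have "isometric L (lattice_of \<kappa> \<rho> \<sigma> \<tau>)"
      unfolding lattice_of_def
      by (rule isometric_swap12[OF isometric_swap23[OF iso[unfolded lattice_of_def]]])
    with never_equal_swap12[OF never_equal_swap23[OF ne]] show ?thesis
      unfolding x by (intro disjI1 free_if_constant)
  next
    case 4
    have iso': "isometric L (lattice_of \<kappa> (\<lambda>s. \<not> \<sigma> (- s)) (\<lambda>s. \<not> \<tau> (- s)) (\<lambda>s. \<not> \<rho> (- s)))"
      using isometric_reversed[OF iso] unfolding reversed_lattice_of .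
    have ne': "never_equal (\<lambda>s. \<not> \<sigma> (- s)) (\<lambda>s. \<not> \<tau> (- s)) (\<lambda>s. \<not> \<rho> (- s))"
      by (rule never_equal_reflect[OF ne])
    \<comment> \<open>Reversal keeps the direction of a step and replaces its threshold
      \<open>k\<close> by \<open>1 - k\<close>, so a threshold sum of 2 becomes 1.\<close>
    have flip: "(\<lambda>s. \<not> k \<le> - s) = (\<lambda>s. 1 - k \<le> s)" "(\<lambda>s. \<not> - s < k) = (\<lambda>s. s < 1 - k)"
      for k :: int
      by auto
    from ne 4 show ?thesis
    proof (cases rule: never_equal_cases)
      case (up x y z)
      from up(4) show ?thesis
      proof
        assume "x + y + z = 1"
        with iso ne \<kappa> show ?thesis unfolding up(1-3) by (intro disjI2 rigid_up)
      next
        assume "x + y + z = 2"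
        then have "(1 - x) + (1 - y) + (1 - z) = 1" by simp
        with iso' ne' \<kappa> show ?thesis unfolding up(1-3) flip by (intro disjI2 rigid_up)
      qed
    next
      case (down x y z)
      from down(4) show ?thesis
      proof
        assume "x + y + z = 1"
        with iso ne \<kappa> show ?thesis unfolding down(1-3) by (intro disjI2 rigid_down)
      next
        assume "x + y + z = 2"
        then have "(1 - x) + (1 - y) + (1 - z) = 1" by simp
        with iso' ne' \<kappa> show ?thesis unfolding down(1-3) flip by (intro disjI2 rigid_down)
      qed
    qed
  qed
qed

end

section \<open>The two widths and the final classification\<close>

lemma has_density_nonzero:
  assumes "has_density f \<alpha>" "\<alpha> \<noteq> 0"
  obtains i where "f i \<noteq> 0"
proof (rule ccontr)
  assume "\<not> thesis"
  then have "f i = 0" for i using that by blast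
  then have "(\<lambda>n. 0 :: real) \<longlonglongrightarrow> \<alpha>" using assms(1) by (simp add: has_density_def)
  then show False using assms(2) by (simp add: LIMSEQ_const_iff)
qed

text \<open>A nonzero slope forces a letter 1, so the width \<open>min_width L + 1\<close> occurs;
  with at most two widths there is no other.\<close>

lemma widths_two_color:
  assumes "two_color L" "has_slope L \<alpha>" "\<alpha> \<noteq> 0"
  shows "widths L = {min_width L, min_width L + 1}"
proof (cases L)
  case (fields a b c)
  let ?\<kappa> = "min_width L"
  have fin: "finite (widths L)" and card: "card (widths L) \<le> 2"
    using assms(1) by (auto simp: two_color_def)
  have "has_density (color_word ?\<kappa> a) \<alpha>"
    using assms(2) by (simp add: has_slope_def fields Let_def)
  then obtain i where "color_word ?\<kappa> a i \<noteq> 0" using has_density_nonzero assms(3) by blast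
  then have "a (i + 1) - a i = ?\<kappa> + 1" by (simp add: color_word_def split: if_splits)
  moreover have "a (i + 1) - a i \<in> widths L" unfolding fields widths.simps by blast
  ultimately have "?\<kappa> + 1 \<in> widths L" by metis
  moreover have "?\<kappa> \<in> widths L"
    unfolding min_width_def using fin calculation by (intro Min_in) auto
  ultimately have sub: "{?\<kappa>, ?\<kappa> + 1} \<subseteq> widths L" by simp
  have "card (widths L) \<le> card {?\<kappa>, ?\<kappa> + 1}" using card by simp
  from card_seteq[OF fin sub this] show ?thesis by (rule sym)
qed

theorem theorem4p7:
  fixes L :: lattice and \<alpha> :: real and p q :: nat and u :: "int list"
  assumes "sturmian_lattice L" and "two_color L" and "has_slope L \<alpha>"
    and "0 < \<alpha>" and "\<alpha> < 1"
    and "coprime p q" and "0 < q" and "\<alpha> = real p / real q"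
    and "u = central_word p q"
  shows "(\<exists>L' f g h. translated L L' \<and> words L' = (f, g, h) \<and>
            central_form u f \<and> central_form u g \<and> central_form u h) \<and>
         ((\<exists>L'. isometric L L' \<and> (\<exists>w. swap_choice w \<and> case_free u w L')) \<noteq>
          (\<exists>L'. isometric L L' \<and> case_rigid u L')) \<and>
         (\<forall>w. swap_choice w \<longrightarrow>
            (\<exists>L'. sturmian_lattice L' \<and> two_color L' \<and> has_slope L' \<alpha> \<and>
                  min_width L' = min_width L \<and> case_free u w L'))"
proof -
  have "0 < p" "p < q" using assms(4,5,7,8) by (simp_all add: zero_less_divide_iff)
  then interpret rational_slope p q using assms(6) by unfold_locales
  obtain a b c where L: "L = (a, b, c)" by (cases L)
  define \<kappa> where "\<kappa> = min_width L"
  have widths: "widths L = {\<kappa>, \<kappa> + 1}"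
    using widths_two_color assms(2-4) by (auto simp: \<kappa>_def)
  then have steps: "a (i + 1) - a i \<in> {\<kappa>, \<kappa> + 1}" "b (i + 1) - b i \<in> {\<kappa>, \<kappa> + 1}"
    "c (i + 1) - c i \<in> {\<kappa>, \<kappa> + 1}" for i
    unfolding L widths.simps by blast+
  have "1 \<le> x" if "x \<in> widths L" for x
    using that assms(1) unfolding L sturmian_lattice_iff separated_def by auto
  then have \<kappa>: "1 \<le> \<kappa>" using widths by blast
  have density: "has_density (color_word \<kappa> a) (real p / real q)"
    "has_density (color_word \<kappa> b) (real p / real q)" "has_density (color_word \<kappa> c) (real p / real q)"
    using assms(3,8) by (simp_all add: has_slope_def L Let_def \<kappa>_def)
  obtain \<sigma> \<tau> \<rho> where ne: "never_equal \<sigma> \<tau> \<rho>"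
    and trans: "translated L (lattice_of \<kappa> \<sigma> \<tau> \<rho>)"
    using normal_form[OF assms(1)[unfolded L] steps density \<kappa>] unfolding L by blast
  show ?thesis
    unfolding assms(9)
  proof (intro conjI)
    show "\<exists>L' f g h. translated L L' \<and> words L' = (f, g, h) \<and>
        central_form (central_word p q) f \<and> central_form (central_word p q) g \<and>
        central_form (central_word p q) h"
      using trans words_lattice_of central_form_word by blast
    show "(\<exists>L'. isometric L L' \<and> (\<exists>w. swap_choice w \<and> case_free (central_word p q) w L')) \<noteq>
        (\<exists>L'. isometric L L' \<and> case_rigid (central_word p q) L')"
      \<comment> \<open>Inequality of propositions is exclusive disjunction: the normal form gives
        one of the cases, and the periodicity invariant rules out both at once.\<close>
      using free_or_rigid[OF translated_isometric[OF trans] ne \<kappa>] some_period_isometric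
        case_free_imp_some_period case_rigid_imp_not_some_period by blast
    show "\<forall>w. swap_choice w \<longrightarrow>
        (\<exists>L'. sturmian_lattice L' \<and> two_color L' \<and> has_slope L' \<alpha> \<and>
              min_width L' = min_width L \<and> case_free (central_word p q) w L')"
    proof (intro allI impI)
      fix w
      assume "swap_choice w"
      then obtain \<upsilon> where w: "w = (\<lambda>s. if \<upsilon> s then [1, 0] else [0, 1])" by (rule swap_choiceE)
      \<comment> \<open>The opposite constants already differ, which leaves
        \<open>\<upsilon>\<close> arbitrary.\<close>
      have "never_equal \<upsilon> (\<lambda>_. False) (\<lambda>_. True)" by (simp add: never_equal_def)
      then show "\<exists>L'. sturmian_lattice L' \<and> two_color L' \<and> has_slope L' \<alpha> \<and>
          min_width L' = min_width L \<and> case_free (central_word p q) w L'"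
        using sturmian_lattice_of[OF _ \<kappa>] two_color_lattice_of has_slope_lattice_of
          min_width_lattice_of case_free_lattice_of
        unfolding w assms(8) \<kappa>_def by blast
    qed
  qed
qed

end
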